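(* Under the setup in the context (fixed, undirected, connected graph): (i) If $\beta>\frac{1}{2f_M}\big(\frac{\gamma\lambda_G^2}{\lambda_2^3}+\gamma\alpha\big)$, then for all $i\in\{1,\dots,N\}$ and $j\in N_i$, $$\lim_{t\to\infty}E\big[(K_2x_i(t)-K_2\bar x(t))^2\big]=0,\qquad \lim_{t\to\infty}E\big[(\hat z_{ij}(t)-K_2x_j(t))^2\big]=0.$$ (ii) If $\gamma>\frac1{\lambda_2}$ and $\beta>\frac{1}{2f_M}\big(\frac{\gamma^2\lambda_G^2}{\lambda_2^2(\gamma\lambda_2-1)}+\gamma\alpha+1\big)$, then there is a constant $C>0$ such that for all $i$, all $j\in N_i$ and all $t\ge t_0+1$, $$E\big[(K_2x_i(t)-K_2\bar x(t))^2\big]\le\frac Ct,\qquad E\big[(\hat z_{ij}(t)-K_2x_j(t))^2\big]\le\frac Ct.$$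
   Context: Fix integers $n\ge 2$ and $N\ge 2$. Let $a_1,\dots,a_n\in\mathbb{R}$, let $A\in\mathbb{R}^{n\times n}$ be the matrix with $A_{k,k+1}=1$ for $k=1,\dots,n-1$, last row $(a_1,a_2,\dots,a_n)$, and all other entries $0$, and let $B=(0,\dots,0,1)^T\in\mathbb{R}^n$. There are $N$ agents with dynamics $x_i(t+1)=Ax_i(t)+Bu_i(t)$, $i=1,\dots,N$, where $x_i(t)=(x_{i1}(t),\dots,x_{in}(t))^T\in\mathbb{R}^n$ and $u_i(t)\in\mathbb{R}$; write $\bar x(t)=\frac1N\sum_{i=1}^N x_i(t)$. Communication graph: $G$ is a fixed, undirected, connected graph on $\{1,\dots,N\}$; $N_i$ is the neighbor set of agent $i$, $d_i=|N_i|$, $d_{\max}=\max_i d_i$, and $L$ is the Laplacian of $G$ (degree matrix minus adjacency matrix), with eigenvalues $0=\lambda_1<\lambda_2\le\dots\le\lambda_N$. Gains: real numbers $b_1,\dots,b_{n-1}$ (compression coefficients), $K_2=[b_1,\dots,b_{n-1},1]\in\mathbb R^{1\times n}$, and $K_1=[-a_1+b_1,\,-a_2+b_2-b_1,\,\dots,\,-a_{n-1}+b_{n-1}-b_{n-2},\,-a_n-b_{n-1}+1]\in\mathbb R^{1\times n}$. Communication: for every ordered pair $(i,j)$ with $j\in N_i$ and every integer $t$, agent $i$ receives the bit $s_{ij}(t)=1$ if $K_2x_j(t)+d_{ij}(t)\le c_{ij}$ and $s_{ij}(t)=0$ otherwise, where $c_{ij}\in\mathbb R$ are fixed thresholds and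 the noises $\{d_{ij}(t)\}$ are i.i.d. $N(0,\sigma^2)$, $\sigma>0$, over all $i,j,t$; $F$ and $f$ denote the distribution function and density of $N(0,\sigma^2)$. Algorithm: fix $\beta>0$, $\gamma>0$, an integer $t_0>\gamma d_{\max}-1$, deterministic initial states $x_i(t_0+1)=x_i^0$ and deterministic initial estimates $\hat z_{ij}(t_0)=\hat z_{ij}^0$, and $M>0$ with $|K_2x_i^0|\le M$ and $|\hat z^0_{ij}|\le M$ for all $i$ and $j\in N_i$. Let $\Pi_M(\zeta)=\max\{-M,\min\{M,\zeta\}\}$ (projection onto $[-M,M]$). For $t\ge t_0+1$, for all $i$ and $j\in N_i$: $\hat z_{ij}(t)=\Pi_M\big(\hat z_{ij}(t-1)+\tfrac{\beta}{t}(F(c_{ij}-\hat z_{ij}(t-1))-s_{ij}(t))\big)$, and $u_i(t)=K_1x_i(t)+\frac{\gamma}{t+1}\sum_{j\in N_i}(\hat z_{ij}(t)-K_2x_i(t))$. Constants: enumerate the $d=\sum_i d_i$ ordered pairs $(i,j)$ with $j\in N_i$ as $p=1,\dots,d$. Let $W\in\mathbb R^{N\times d}$ with $W_{k,p}=1$ if pair $p$ has first component $k$ and $0$ otherwise; $Q\in\mathbb R^{d\times N}$ with $Q_{p,k}=1$ if pair $p$ has second component $k$ and $0$ otherwise; $J_N=I_N-\frac1N\mathbf 1_N\mathbf 1_N^T$. With $\|\cdot\|$ the spectral norm, set $\lambda_G=\|J_NW\|^2$, $\lambda_{QW}=\|QW\|^2$, $\lambda_{QL}=\|QL\|^2$,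 $\alpha=2\sqrt{\lambda_{QW}}+\lambda_{QL}\lambda_2/\lambda_G$, and $f_M=\min_{(i,j):\,j\in N_i} f(|c_{ij}|+M)$. *)

theory Defs
  imports "HOL-Probability.Probability" "Jordan_Normal_Form.Char_Poly"
begin

(* Conventions: agents are 1..N, vector components are 1..n; vectors in R^n are
   functions nat => real of which only the components 1..n are used. *)

definition projM :: "real \<Rightarrow> real \<Rightarrow> real" where
  "projM Mb z = max (- Mb) (min Mb z)"

(* (A x)_k for k in 1..n: A_{k,k+1} = 1 (k<n), last row (a_1,...,a_n) *)
definition Amul :: "nat \<Rightarrow> (nat \<Rightarrow> real) \<Rightarrow> (nat \<Rightarrow> real) \<Rightarrow> nat \<Rightarrow> real" where
  "Amul n a x k = (if k < n then x (k + 1) else (\<Sum>l = 1..n. a l * x l))"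

(* B u: the vector (0,...,0,u) *)
definition Bmul :: "nat \<Rightarrow> real \<Rightarrow> nat \<Rightarrow> real" where
  "Bmul n u k = (if k = n then u else 0)"

(* K2 = [b_1, ..., b_{n-1}, 1] *)
definition K2coef :: "nat \<Rightarrow> (nat \<Rightarrow> real) \<Rightarrow> nat \<Rightarrow> real" where
  "K2coef n b k = (if k < n then b k else 1)"

(* K1 = [-a_1+b_1, -a_2+b_2-b_1, ..., -a_{n-1}+b_{n-1}-b_{n-2}, -a_n-b_{n-1}+1] *)
definition K1coef :: "nat \<Rightarrow> (nat \<Rightarrow> real) \<Rightarrow> (nat \<Rightarrow> real) \<Rightarrow> nat \<Rightarrow> real" where
  "K1coef n a b k =
     (if k = 1 then - a 1 + b 1
      else if k < n then - a k + b k - b (k - 1)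
      else - a n - b (n - 1) + 1)"

definition rowmul :: "nat \<Rightarrow> (nat \<Rightarrow> real) \<Rightarrow> (nat \<Rightarrow> real) \<Rightarrow> real" where
  "rowmul n K x = (\<Sum>k = 1..n. K k * x k)"

(* Normal distribution N(0, sigma^2): density f and distribution function F *)
definition gauss_pdf :: "real \<Rightarrow> real \<Rightarrow> real" where
  "gauss_pdf \<sigma> y = normal_density 0 \<sigma> y"

definition gauss_cdf :: "real \<Rightarrow> real \<Rightarrow> real" where
  "gauss_cdf \<sigma> = cdf (density lborel (\<lambda>y. ennreal (normal_density 0 \<sigma> y)))"

(* Graphs: neighbour sets Nb i for vertices 1..N *)
definition undirected_graph :: "nat \<Rightarrow> (nat \<Rightarrow> nat set) \<Rightarrow> bool" where
  "undirected_graph N Nb \<longleftrightarrow>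
     (\<forall>i \<in> {1..N}. Nb i \<subseteq> {1..N} - {i} \<and> (\<forall>j \<in> Nb i. i \<in> Nb j))"

definition graph_edges :: "nat \<Rightarrow> (nat \<Rightarrow> nat set) \<Rightarrow> (nat \<times> nat) set" where
  "graph_edges N Nb = {(i, j). i \<in> {1..N} \<and> j \<in> Nb i}"

definition graph_connected :: "nat \<Rightarrow> (nat \<Rightarrow> nat set) \<Rightarrow> bool" where
  "graph_connected N Nb \<longleftrightarrow> (\<forall>i \<in> {1..N}. \<forall>j \<in> {1..N}. (i, j) \<in> (graph_edges N Nb)\<^sup>*)"

(* ordered pairs (i,j) with j in N_i *)
definition pairs :: "nat \<Rightarrow> (nat \<Rightarrow> nat set) \<Rightarrow> (nat \<times> nat) set" where
  "pairs N Nb = {(i, j). i \<in> {1..N} \<and> j \<in> Nb i}"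

definition dmax :: "nat \<Rightarrow> (nat \<Rightarrow> nat set) \<Rightarrow> nat" where
  "dmax N Nb = Max ((\<lambda>i. card (Nb i)) ` {1..N})"

(* Matrices as functions row index => column index => real, with explicit index sets *)
definition matprod :: "'k set \<Rightarrow> ('r \<Rightarrow> 'k \<Rightarrow> real) \<Rightarrow> ('k \<Rightarrow> 'c \<Rightarrow> real) \<Rightarrow> 'r \<Rightarrow> 'c \<Rightarrow> real" where
  "matprod S A B r c = (\<Sum>s \<in> S. A r s * B s c)"

(* spectral norm (operator 2-norm) of a matrix with rows R and columns C *)
definition spec_norm :: "'r set \<Rightarrow> 'c set \<Rightarrow> ('r \<Rightarrow> 'c \<Rightarrow> real) \<Rightarrow> real" where
  "spec_norm R C A = Sup {sqrt (\<Sum>r \<in> R. (\<Sum>c \<in> C. A r c * v c)\<^sup>2) | v. (\<Sum>c \<in> C. (v c)\<^sup>2) = 1}"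

definition laplacian :: "(nat \<Rightarrow> nat set) \<Rightarrow> nat \<Rightarrow> nat \<Rightarrow> real" where
  "laplacian Nb i k = (if i = k then real (card (Nb i)) else if k \<in> Nb i then -1 else 0)"

(* W: N x d, W_{k,p} = 1 iff first component of p is k; columns indexed by the pairs *)
definition Wmat :: "nat \<Rightarrow> nat \<times> nat \<Rightarrow> real" where
  "Wmat k p = (if fst p = k then 1 else 0)"

(* Q: d x N, Q_{p,k} = 1 iff second component of p is k *)
definition Qmat :: "nat \<times> nat \<Rightarrow> nat \<Rightarrow> real" where
  "Qmat p k = (if snd p = k then 1 else 0)"

definition Jmat :: "nat \<Rightarrow> nat \<Rightarrow> nat \<Rightarrow> real" where
  "Jmat N r c = (if r = c then 1 else 0) - 1 / real N"

(* eigenvalues of the Laplacian, with multiplicity, in increasing order: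
   roots of the characteristic polynomial *)
definition lap_eigs :: "nat \<Rightarrow> (nat \<Rightarrow> nat set) \<Rightarrow> real list" where
  "lap_eigs N Nb = sorted_list_of_multiset
     (proots (char_poly (Matrix.mat N N (\<lambda>(r, c). laplacian Nb (r + 1) (c + 1)))))"

(* lambda_2: second smallest eigenvalue *)
definition lambda2 :: "nat \<Rightarrow> (nat \<Rightarrow> nat set) \<Rightarrow> real" where
  "lambda2 N Nb = lap_eigs N Nb ! 1"

definition lambdaG :: "nat \<Rightarrow> (nat \<Rightarrow> nat set) \<Rightarrow> real" where
  "lambdaG N Nb = (spec_norm {1..N} (pairs N Nb) (matprod {1..N} (Jmat N) Wmat))\<^sup>2"

definition lambdaQW :: "nat \<Rightarrow> (nat \<Rightarrow> nat set) \<Rightarrow> real" where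
  "lambdaQW N Nb = (spec_norm (pairs N Nb) (pairs N Nb) (matprod {1..N} Qmat Wmat))\<^sup>2"

definition lambdaQL :: "nat \<Rightarrow> (nat \<Rightarrow> nat set) \<Rightarrow> real" where
  "lambdaQL N Nb = (spec_norm (pairs N Nb) {1..N} (matprod {1..N} Qmat (laplacian Nb)))\<^sup>2"

definition alpha_const :: "nat \<Rightarrow> (nat \<Rightarrow> nat set) \<Rightarrow> real" where
  "alpha_const N Nb = 2 * sqrt (lambdaQW N Nb) + lambdaQL N Nb * lambda2 N Nb / lambdaG N Nb"

definition fM_const :: "real \<Rightarrow> (nat \<Rightarrow> nat \<Rightarrow> real) \<Rightarrow> real \<Rightarrow> nat \<Rightarrow> (nat \<Rightarrow> nat set) \<Rightarrow> real" where
  "fM_const \<sigma> c Mb N Nb = Min ((\<lambda>(i, j). gauss_pdf \<sigma> (\<bar>c i j\<bar> + Mb)) ` pairs N Nb)"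

end

theory Submission
  imports Defs
begin

text \<open>
  Since \<open>K2 (A + B K1) = K2\<close>, the scalars \<open>y i = K2 x i\<close> evolve autonomously: with
  \<open>h = \<gamma> / (t + 1)\<close>, the estimation errors \<open>e (i, j) = zh i j - y j\<close> and the
  disagreement \<open>\<delta> = J y\<close> one has \<open>\<delta>' = \<delta> - h L \<delta> + h J W e\<close>. The condition on \<open>t0\<close>
  makes each step a convex combination, so \<open>y\<close> stays in \<open>[-M, M]\<close>. There the Gaussian
  distribution function has slope at least \<open>fM\<close>, and the noise of time \<open>t + 1\<close> is
  independent of \<open>zh t\<close> and \<open>y (t + 1)\<close>, so one estimation step contracts the mean square
  error by the factor \<open>1 - 2 \<beta> fM / (t + 1)\<close>. With \<open>V = E |\<delta>|^2\<close>, \<open>R = E |e|^2\<close>,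
  \<open>s = t + 1\<close> and \<open>q = \<gamma> lambdaG / lambda2\<close>, Young's inequality gives, up to \<open>O(1 / s^2)\<close>,

  \<open>V' \<le> V + (- \<gamma> lambda2 V + q R) / s\<close> and
  \<open>R' \<le> R + (q V - (2 \<beta> fM - \<gamma> alpha) R) / s\<close>.

  The conditions on \<open>\<beta>\<close> and \<open>\<gamma>\<close> say exactly that some \<open>U = p V + R\<close> satisfies
  \<open>U' \<le> (1 - \<kappa> / s) U + O(1 / s^2)\<close> with \<open>\<kappa> > 0\<close> in (i) and with \<open>\<kappa> > 1\<close> in (ii).

  That \<open>lambda2\<close>, a root of the characteristic polynomial, is positive and bounds the
  Laplacian form from below on vectors of sum zero follows by minimising that form over the unit
  sphere: the minimiser is an eigenvector with a positive eigenvalue, and 0 is a simple root.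
\<close>

section \<open>The Laplacian of a connected graph\<close>

lemma graph_finite_Nb: "undirected_graph N Nb \<Longrightarrow> i \<in> {1..N} \<Longrightarrow> finite (Nb i)"
  unfolding undirected_graph_def by (meson finite_Diff finite_atLeastAtMost finite_subset)

lemma pairs_Sigma: "pairs N Nb = Sigma {1..N} Nb"
  by (auto simp: pairs_def)

lemma finite_pairs: "undirected_graph N Nb \<Longrightarrow> finite (pairs N Nb)"
  unfolding pairs_Sigma by (rule finite_SigmaI) (auto intro: graph_finite_Nb)

lemma sum_pairs:
  assumes "undirected_graph N Nb"
  shows "(\<Sum>p\<in>pairs N Nb. g (fst p) (snd p)) = (\<Sum>i\<in>{1..N}. \<Sum>j\<in>Nb i. g i j)"
  unfolding pairs_Sigma using assms
  by (subst sum.Sigma) (auto simp: graph_finite_Nb case_prod_beta)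

lemma pairs_swap:
  assumes "undirected_graph N Nb" "(i, j) \<in> pairs N Nb"
  shows "(j, i) \<in> pairs N Nb"
  using assms unfolding undirected_graph_def pairs_def by fastforce

lemma pairs_in:
  assumes "undirected_graph N Nb" "p \<in> pairs N Nb"
  shows "fst p \<in> {1..N}" "snd p \<in> {1..N}"
  using assms unfolding undirected_graph_def pairs_def by fastforce+

lemma sum_pairs_swap:
  assumes "undirected_graph N Nb"
  shows "(\<Sum>p\<in>pairs N Nb. g (fst p) (snd p)) = (\<Sum>p\<in>pairs N Nb. g (snd p) (fst p))"
  by (rule sum.reindex_bij_witness[where i = prod.swap and j = prod.swap])
    (auto intro: pairs_swap[OF assms])

lemma laplacian_apply:
  assumes "undirected_graph N Nb" "i \<in> {1..N}"
  shows "(\<Sum>k\<in>{1..N}. laplacian Nb i k * v k) = (\<Sum>j\<in>Nb i. v i - v j)"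
proof -
  have sub: "Nb i \<subseteq> {1..N}" and i: "i \<notin> Nb i"
    using assms by (auto simp: undirected_graph_def)
  have "(\<Sum>k\<in>{1..N}. laplacian Nb i k * v k)
      = (\<Sum>k\<in>{1..N}. (if k = i then real (card (Nb i)) * v i else 0) + (if k \<in> Nb i then - v k else 0))"
    using i by (intro sum.cong) (auto simp: laplacian_def)
  also have "\<dots> = real (card (Nb i)) * v i + (\<Sum>k\<in>{1..N}. if k \<in> Nb i then - v k else 0)"
    using assms(2) by (simp add: sum.distrib)
  also have "(\<Sum>k\<in>{1..N}. if k \<in> Nb i then - v k else 0) = (\<Sum>k\<in>Nb i. - v k)"
    using sub by (simp add: sum.inter_restrict[symmetric] Int_absorb1)
  finally show ?thesis
    by (simp add: sum_subtractf sum_negf)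
qed

text \<open>The sum over ordered pairs is invariant under swapping, so averaging it with its swapped
  copy symmetrises it; the factor 1/2 is there because every edge occurs in both orientations. Two
  separate arguments are kept so that \<open>u = 1\<close>, \<open>u = v\<close> and the polarised
  form in the variational argument are all instances.\<close>

lemma laplacian_form:
  fixes u v :: "nat \<Rightarrow> real"
  assumes "undirected_graph N Nb"
  shows "(\<Sum>i\<in>{1..N}. u i * (\<Sum>j\<in>Nb i. v i - v j))
       = (\<Sum>p\<in>pairs N Nb. (u (fst p) - u (snd p)) * (v (fst p) - v (snd p))) / 2"
proof -
  have "(\<Sum>i\<in>{1..N}. u i * (\<Sum>j\<in>Nb i. v i - v j)) = (\<Sum>p\<in>pairs N Nb. u (fst p) * (v (fst p) - v (snd p)))"
    using sum_pairs[OF assms, of "\<lambda>i j. u i * (v i - v j)"] by (simp add: sum_distrib_left)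
  moreover have "(\<Sum>p\<in>pairs N Nb. u (fst p) * (v (fst p) - v (snd p))) = (\<Sum>p\<in>pairs N Nb. u (snd p) * (v (snd p) - v (fst p)))"
    using sum_pairs_swap[OF assms, of "\<lambda>i j. u i * (v i - v j)"] by simp
  moreover have "(\<Sum>p\<in>pairs N Nb. (u (fst p) - u (snd p)) * (v (fst p) - v (snd p)))
    = (\<Sum>p\<in>pairs N Nb. u (fst p) * (v (fst p) - v (snd p))) + (\<Sum>p\<in>pairs N Nb. u (snd p) * (v (snd p) - v (fst p)))"
    by (simp add: sum.distrib[symmetric] algebra_simps)
  ultimately show ?thesis by simp
qed

lemma laplacian_sum_zero:
  fixes v :: "nat \<Rightarrow> real"
  assumes "undirected_graph N Nb"
  shows "(\<Sum>i\<in>{1..N}. \<Sum>j\<in>Nb i. v i - v j) = 0"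
  using laplacian_form[OF assms, of "\<lambda>_. 1" v] by simp

lemma laplacian_form_nonneg:
  fixes v :: "nat \<Rightarrow> real"
  assumes "undirected_graph N Nb"
  shows "(\<Sum>i\<in>{1..N}. v i * (\<Sum>j\<in>Nb i. v i - v j)) \<ge> 0"
  unfolding laplacian_form[OF assms] by (simp add: sum_nonneg)

text \<open>A vanishing sum of squares makes \<open>v\<close> constant along every edge, and
  connectivity spreads the value along paths.\<close>

lemma laplacian_form_zero_const:
  fixes v :: "nat \<Rightarrow> real"
  assumes G: "undirected_graph N Nb" and conn: "graph_connected N Nb"
    and z: "(\<Sum>i\<in>{1..N}. v i * (\<Sum>j\<in>Nb i. v i - v j)) = 0"
    and ij: "i \<in> {1..N}" "j \<in> {1..N}"
  shows "v i = v j"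
proof -
  have "(\<Sum>p\<in>pairs N Nb. (v (fst p) - v (snd p)) * (v (fst p) - v (snd p))) = 0"
    using z unfolding laplacian_form[OF G] by simp
  then have e: "\<forall>p\<in>pairs N Nb. v (fst p) = v (snd p)"
    by (subst (asm) sum_nonneg_eq_0_iff) (auto simp: finite_pairs[OF G])
  have "(i, j) \<in> (graph_edges N Nb)\<^sup>*"
    using conn ij unfolding graph_connected_def by blast
  then show ?thesis
    by induction (use e in \<open>auto simp: graph_edges_def pairs_def\<close>)
qed

section \<open>Laplacian eigenvalues as roots of the characteristic polynomial\<close>

lemma sum_shift_index: "(\<Sum>i\<in>{1..N::nat}. g i) = (\<Sum>i\<in>{0..<N}. g (i + 1))"
  by (rule sum.reindex_bij_witness[of _ "\<lambda>i. i + 1" "\<lambda>i. i - 1"]) auto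

text \<open>A name for the matrix inside \<open>lap_eigs\<close>. Its rows and columns are 0-based
  while the vertices are 1-based, hence the shifts.\<close>

definition lap_mat :: "nat \<Rightarrow> (nat \<Rightarrow> nat set) \<Rightarrow> real mat" where
  "lap_mat N Nb = Matrix.mat N N (\<lambda>(r, c). laplacian Nb (r + 1) (c + 1))"

lemma lap_mat_carrier [simp]: "lap_mat N Nb \<in> carrier_mat N N"
  by (simp add: lap_mat_def)

lemma lap_mat_mult_vec:
  assumes "undirected_graph N Nb" "r < N" "dim_vec w = N"
  shows "vec_index (lap_mat N Nb *\<^sub>v w) r = (\<Sum>j\<in>Nb (r + 1). vec_index w r - vec_index w (j - 1))"
proof -
  have "vec_index (lap_mat N Nb *\<^sub>v w) r = (\<Sum>c\<in>{0..<N}. laplacian Nb (r + 1) (c + 1) * vec_index w (c + 1 - 1))"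
    using assms by (simp add: lap_mat_def scalar_prod_def)
  also have "\<dots> = (\<Sum>k\<in>{1..N}. laplacian Nb (r + 1) k * vec_index w (k - 1))"
    by (simp only: sum_shift_index)
  also have "\<dots> = (\<Sum>j\<in>Nb (r + 1). vec_index w (r + 1 - 1) - vec_index w (j - 1))"
    using assms by (intro laplacian_apply) auto
  finally show ?thesis by simp
qed

text \<open>The bridge from matrix eigenvectors to functions on the vertices 1..N; after it,
  eigenvalues are handled through neighbour sums.\<close>

lemma char_poly_lap_root_iff:
  assumes G: "undirected_graph N Nb"
  shows "poly (char_poly (lap_mat N Nb)) m = 0 \<longleftrightarrow>
    (\<exists>v. (\<exists>i\<in>{1..N}. v i \<noteq> 0) \<and> (\<forall>i\<in>{1..N}. (\<Sum>j\<in>Nb i. v i - v j) = m * v i))"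
    (is "?l \<longleftrightarrow> ?r")
proof -
  have "?l \<longleftrightarrow> eigenvalue (lap_mat N Nb) m"
    using eigenvalue_root_char_poly[OF lap_mat_carrier] by blast
  also have "\<dots> \<longleftrightarrow> ?r"
  proof
    assume "eigenvalue (lap_mat N Nb) m"
    then obtain w where w: "w \<in> carrier_vec N" "w \<noteq> 0\<^sub>v N" "lap_mat N Nb *\<^sub>v w = m \<cdot>\<^sub>v w"
      unfolding eigenvalue_def eigenvector_def by (auto simp: lap_mat_def)
    obtain r where r: "r < N" "vec_index w r \<noteq> 0"
      using w(1,2) by (metis carrier_vecD eq_vecI index_zero_vec(1) index_zero_vec(2))
    define v where "v i = vec_index w (i - 1)" for i
    have "(\<Sum>j\<in>Nb i. v i - v j) = m * v i" if "i \<in> {1..N}" for i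
      using lap_mat_mult_vec[OF G, of "i - 1" w] that w(1,3) by (auto simp: v_def)
    moreover have "v (r + 1) \<noteq> 0" "r + 1 \<in> {1..N}" using r by (auto simp: v_def)
    ultimately show ?r by blast
  next
    assume ?r
    then obtain v i where i: "i \<in> {1..N}" "v i \<noteq> 0"
      and v: "\<And>i. i \<in> {1..N} \<Longrightarrow> (\<Sum>j\<in>Nb i. v i - v j) = m * v i" by blast
    define w where "w = Matrix.vec N (\<lambda>r. v (r + 1))"
    have "vec_index w (i - 1) \<noteq> 0" using i by (auto simp: w_def)
    then have "w \<noteq> 0\<^sub>v N" using i by auto
    moreover have "lap_mat N Nb *\<^sub>v w = m \<cdot>\<^sub>v w"
    proof (rule eq_vecI)
      fix r assume "r < dim_vec (m \<cdot>\<^sub>v w)"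
      then have r: "r < N" by (simp add: w_def)
      have "(\<Sum>j\<in>Nb (r + 1). vec_index w r - vec_index w (j - 1)) = (\<Sum>j\<in>Nb (r + 1). v (r + 1) - v j)"
      proof (intro sum.cong refl)
        fix j assume "j \<in> Nb (r + 1)"
        then have "j \<in> {1..N}" using G r unfolding undirected_graph_def by fastforce
        then show "vec_index w r - vec_index w (j - 1) = v (r + 1) - v j" using r by (auto simp: w_def)
      qed
      then show "vec_index (lap_mat N Nb *\<^sub>v w) r = vec_index (m \<cdot>\<^sub>v w) r"
        using r v[of "r + 1"] lap_mat_mult_vec[OF G, of r w] by (simp add: w_def)
    qed (simp add: w_def lap_mat_def)
    ultimately show "eigenvalue (lap_mat N Nb) m"
      unfolding eigenvalue_def eigenvector_def by (intro exI[of _ w]) (auto simp: w_def lap_mat_def)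
  qed
  finally show ?thesis .
qed

text \<open>Pairing the eigenvector equation with the eigenvector itself gives \<open>m\<close>
  times a positive square norm, and the form is nonnegative.\<close>

lemma char_poly_lap_root_nonneg:
  assumes G: "undirected_graph N Nb" and "poly (char_poly (lap_mat N Nb)) m = 0"
  shows "m \<ge> 0"
proof -
  obtain v i where i: "i \<in> {1..N}" "v i \<noteq> 0"
      and v: "\<And>i. i \<in> {1..N} \<Longrightarrow> (\<Sum>j\<in>Nb i. v i - v j) = m * v i"
    using assms char_poly_lap_root_iff by blast
  have "(\<Sum>i\<in>{1..N}. v i * (\<Sum>j\<in>Nb i. v i - v j)) = m * (\<Sum>i\<in>{1..N}. (v i)\<^sup>2)"
    by (simp add: v sum_distrib_left power2_eq_square algebra_simps)
  then have "m * (\<Sum>i\<in>{1..N}. (v i)\<^sup>2) \<ge> 0"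
    using laplacian_form_nonneg[OF G, of v] by simp
  moreover have "(\<Sum>i\<in>{1..N}. (v i)\<^sup>2) > 0"
    using i by (intro sum_pos2[of _ i]) auto
  ultimately show ?thesis by (simp add: zero_le_mult_iff)
qed

text \<open>Adding all columns of \<open>X I - L\<close> to the first one turns that column into \<open>X\<close> times the
  all-ones vector, because the rows of \<open>L\<close> sum to zero. Hence the eigenvalue 0 splits off
  exactly once.\<close>

lemma char_poly_lap_factor:
  assumes G: "undirected_graph N Nb" and conn: "graph_connected N Nb" and N: "N \<ge> 1"
  obtains q where "char_poly (lap_mat N Nb) = [:0, 1:] * q" "poly q 0 \<noteq> 0"
proof -
  define A where "A = lap_mat N Nb"
  define CP where "CP = char_poly_matrix A"
  \<comment> \<open>These matrices realise the column operation as \<open>CP * P = M * D\<close>: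
    \<open>P\<close> adds all columns to the first, \<open>D\<close> carries the common factor X of
    the new first column, and \<open>M\<close> is what remains, with ones in that column. Taking
    determinants splits off X.\<close>
  define M where "M = Matrix.mat N N (\<lambda>(r, c). if c = 0 then 1 else CP $$ (r, c))"
  define P :: "real poly mat" where "P = Matrix.mat N N (\<lambda>(r, c). if c = 0 \<or> r = c then 1 else 0)"
  define D :: "real poly mat" where
    "D = Matrix.mat N N (\<lambda>(r, c). if r = c then if c = 0 then [:0, 1:] else 1 else 0)"
  have [simp]: "A \<in> carrier_mat N N" "CP \<in> carrier_mat N N" "M \<in> carrier_mat N N"
    "P \<in> carrier_mat N N" "D \<in> carrier_mat N N"
    by (auto simp: A_def CP_def M_def P_def D_def)
  have CPe: "CP $$ (r, c) = (if r = c then [:0, 1:] else 0) - [:laplacian Nb (r + 1) (c + 1):]"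
    if "r < N" "c < N" for r c
    using that by (auto simp: CP_def char_poly_matrix_def A_def lap_mat_def)
  have row: "(\<Sum>k\<in>{0..<N}. CP $$ (r, k)) = [:0, 1:]" if "r < N" for r
  proof -
    have "(\<Sum>k\<in>{0..<N}. laplacian Nb (r + 1) (k + 1)) = 0"
      using laplacian_apply[OF G, of "r + 1" "\<lambda>_. 1"] that
        sum_shift_index[of "\<lambda>k. laplacian Nb (r + 1) k" N] by simp
    moreover have "(\<Sum>k\<in>{0..<N}. CP $$ (r, k))
        = (\<Sum>k\<in>{0..<N}. (if r = k then [:0, 1:] else 0)) - (\<Sum>k\<in>{0..<N}. [:laplacian Nb (r + 1) (k + 1):])"
      unfolding sum_subtractf[symmetric] by (intro sum.cong refl) (use CPe that in auto)
    moreover have "(\<Sum>k\<in>{0..<N}. [:g k:]) = [:\<Sum>k\<in>{0..<N}. g k:]" for g :: "nat \<Rightarrow> real"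
      by (induction N) auto
    ultimately show ?thesis using that by simp
  qed
  have "CP * P = M * D"
  proof (rule eq_matI)
    fix r c assume "r < dim_row (M * D)" "c < dim_col (M * D)"
    then have rc: "r < N" "c < N" by (auto simp: M_def D_def)
    have "(CP * P) $$ (r, c) = (\<Sum>k\<in>{0..<N}. CP $$ (r, k) * P $$ (k, c))"
      using rc carrier_matD[of CP N N] carrier_matD[of P N N] by (simp add: scalar_prod_def)
    also have "\<dots> = (if c = 0 then [:0, 1:] else CP $$ (r, c))"
    proof (cases "c = 0")
      case True
      then show ?thesis using row rc by (simp add: P_def)
    next
      case False
      then have "(\<Sum>k\<in>{0..<N}. CP $$ (r, k) * P $$ (k, c)) = (\<Sum>k\<in>{0..<N}. if k = c then CP $$ (r, c) else 0)"
        using rc by (intro sum.cong) (auto simp: P_def)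
      then show ?thesis using False rc by simp
    qed
    also have "\<dots> = (\<Sum>k\<in>{0..<N}. if k = c then M $$ (r, c) * D $$ (c, c) else 0)"
      using rc by (simp add: M_def D_def)
    also have "\<dots> = (\<Sum>k\<in>{0..<N}. M $$ (r, k) * D $$ (k, c))"
      using rc by (intro sum.cong) (auto simp: D_def)
    also have "\<dots> = (M * D) $$ (r, c)"
      using rc carrier_matD[of M N N] carrier_matD[of D N N] by (simp add: scalar_prod_def)
    finally show "(CP * P) $$ (r, c) = (M * D) $$ (r, c)" .
  qed (auto simp: CP_def P_def M_def D_def A_def lap_mat_def char_poly_matrix_def)
  then have "det CP * det P = det M * det D"
    using det_mult[of CP N P] det_mult[of M N D] by simp
  moreover have "det P = 1"
    by (subst det_lower_triangular[of N]) (auto simp: P_def diag_mat_def intro!: prod_list_neutral)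
  moreover have "det D = [:0, 1:]"
  proof -
    have "det D = prod_list (diag_mat D)"
      by (rule det_upper_triangular[of _ N]) (auto simp: D_def)
    also have "\<dots> = (\<Prod>i\<in>{0..<N}. if i = 0 then [:0, 1:] else 1)"
      by (subst prod_list_diag_prod) (auto simp: D_def)
    also have "\<dots> = [:0, 1:]" using N by simp
    finally show ?thesis .
  qed
  ultimately have "char_poly A = [:0, 1:] * det M"
    by (simp add: char_poly_def CP_def)
  moreover have "poly (det M) 0 \<noteq> 0"
  proof
    define M0 :: "real mat" where
      "M0 = Matrix.mat N N (\<lambda>(r, c). if c = 0 then 1 else - laplacian Nb (r + 1) (c + 1))"
    assume "poly (det M) 0 = 0"
    moreover have "poly (det M) 0 = det M0"
      by (rule poly_det_cong[of _ N]) (auto simp: M_def M0_def CPe)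
    ultimately have "det M0 = 0" by simp
    then obtain w where w: "w \<in> carrier_vec N" "w \<noteq> 0\<^sub>v N" "M0 *\<^sub>v w = 0\<^sub>v N"
      using det_0_iff_vec_prod_zero_field[of M0 N] by (auto simp: M0_def)
    \<comment> \<open>A kernel vector \<open>w\<close> of \<open>M0\<close> says that the Laplacian
      maps \<open>v\<close>, which is \<open>w\<close> with its first entry replaced by 0, to the
      constant first entry of \<open>w\<close>. Summing over all vertices makes that constant 0;
      then \<open>v\<close> has zero form, so it is constant, and it vanishes at vertex 1.\<close>
    define v where "v i = (if i = 1 then 0 else vec_index w (i - 1))" for i :: nat
    have Lv: "(\<Sum>j\<in>Nb i. v i - v j) = vec_index w 0" if i: "i \<in> {1..N}" for i
    proof -
      have "0 = vec_index (M0 *\<^sub>v w) (i - 1)" using w(3) i by (auto simp: less_diff_conv2)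
      also have "\<dots> = (\<Sum>c\<in>{0..<N}. (if c = 0 then vec_index w 0 else 0) - laplacian Nb i (c + 1) * v (c + 1))"
        using i w(1) by (auto simp: M0_def scalar_prod_def v_def intro!: sum.cong)
      also have "\<dots> = vec_index w 0 - (\<Sum>k\<in>{1..N}. laplacian Nb i k * v k)"
        using N by (simp add: sum_subtractf sum_shift_index[of "\<lambda>k. laplacian Nb i k * v k", simplified])
      finally show ?thesis using laplacian_apply[OF G i, of v] by simp
    qed
    then have "real N * vec_index w 0 = 0"
      using laplacian_sum_zero[OF G, of v] by simp
    then have w0: "vec_index w 0 = 0" using N by simp
    then have "(\<Sum>i\<in>{1..N}. v i * (\<Sum>j\<in>Nb i. v i - v j)) = 0" using Lv by simp
    then have v1: "v i = v 1" if "i \<in> {1..N}" for i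
      using laplacian_form_zero_const[OF G conn, of v i 1] that N by simp
    have "vec_index w r = 0" if "r < N" for r
      using v1[of "r + 1"] that w0 by (cases "r = 0") (auto simp: v_def)
    then have "w = 0\<^sub>v N" using w(1) by (intro eq_vecI) auto
    then show False using w(2) by simp
  qed
  ultimately show thesis using that A_def by blast
qed

text \<open>The root 0 is simple and the roots of the cofactor \<open>q\<close> are positive, so the
  sorted list is 0 followed by positive roots and index 1 is the smallest of these. The given root
  \<open>m\<close> guarantees that this entry exists.\<close>

lemma lambda2_props:
  assumes G: "undirected_graph N Nb" and conn: "graph_connected N Nb" and N: "N \<ge> 1"
    and m: "poly (char_poly (lap_mat N Nb)) m = 0" "m > 0"
  shows "0 < lambda2 N Nb" "lambda2 N Nb \<le> m"
proof -
  obtain q where q: "char_poly (lap_mat N Nb) = [:0, 1:] * q" "poly q 0 \<noteq> 0"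
    using char_poly_lap_factor[OF G conn N] by blast
  have q0: "q \<noteq> 0" using q(2) by auto
  then have "proots (char_poly (lap_mat N Nb)) = proots [:0, 1:] + proots q"
    unfolding q(1) by (intro proots_mult) auto
  moreover have "proots [:0, 1 :: real:] = {#0#}"
    using proots_linear_factor[of "0 :: real"] by simp
  ultimately have e: "lap_eigs N Nb = insort 0 (sorted_list_of_multiset (proots q))"
    by (simp add: lap_eigs_def lap_mat_def)
  have pos: "r > 0" if "r \<in># proots q" for r
  proof -
    have "poly q r = 0" using that q0 by simp
    then show ?thesis using char_poly_lap_root_nonneg[OF G, of r] q by (cases "r = 0") auto
  qed
  have mq: "m \<in># proots q" using m q q0 by simp
  define l where "l = sorted_list_of_multiset (proots q)"
  have l: "sorted l" "set l = set_mset (proots q)" by (auto simp: l_def)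
  then obtain h l' where hl: "l = h # l'" using mq by (cases l) auto
  have "h > 0" using pos[of h] l(2) hl by (metis list.set_intros(1))
  then have "lap_eigs N Nb = 0 # l" using e hl unfolding l_def[symmetric] by simp
  then have "lambda2 N Nb = h" by (simp add: lambda2_def hl)
  moreover have "m \<in> set l" using l(2) mq by simp
  ultimately show "0 < lambda2 N Nb" "lambda2 N Nb \<le> m" using \<open>h > 0\<close> l(1) hl by auto
qed

section \<open>Minimising the Laplacian form on the unit sphere of sum-zero vectors\<close>

lemma quadratic_nonneg_linear_zero:
  fixes a b :: real
  assumes "\<And>t. 2 * t * a + t\<^sup>2 * b \<ge> 0" "b \<ge> 0"
  shows "a = 0"
proof (rule ccontr)
  assume a: "a \<noteq> 0"
  \<comment> \<open>The natural test point is the minimiser \<open>- a / b\<close>; the denominator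
    \<open>b + 1\<close> covers \<open>b = 0\<close> as well and still gives a negative
    value.\<close>
  have "2 * (- a / (b + 1)) * a + (- a / (b + 1))\<^sup>2 * b = - (a\<^sup>2 * (b + 2)) / (b + 1)\<^sup>2"
    using assms(2) by (simp add: divide_simps) (simp add: power2_eq_square algebra_simps)
  moreover have "- (a\<^sup>2 * (b + 2)) / (b + 1)\<^sup>2 < 0"
    using a assms(2) by (auto intro!: divide_neg_pos mult_pos_pos)
  ultimately show False using assms(1)[of "- a / (b + 1)"] by linarith
qed

text \<open>The vectors live in the function space over all naturals with the product topology.
  Being zero outside 1..N, the sphere is a closed subset of a product of intervals and singletons,
  which is compact by Tychonoff.\<close>

lemma compact_sphere_sum_zero:
  "compact {v :: nat \<Rightarrow> real. (\<forall>i. i \<notin> {1..N} \<longrightarrow> v i = 0) \<and>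
     (\<Sum>i\<in>{1..N}. v i) = 0 \<and> (\<Sum>i\<in>{1..N}. (v i)\<^sup>2) = 1}" (is "compact ?S")
proof -
  define K :: "nat \<Rightarrow> real set" where "K i = (if i \<in> {1..N} then {-1..1} else {0})" for i
  have "compactin (product_topology (\<lambda>_. euclidean) UNIV) (Pi\<^sub>E UNIV K)"
    by (subst compactin_PiE) (auto simp: K_def)
  then have "compact (Pi\<^sub>E UNIV K)"
    by (simp add: euclidean_product_topology)
  moreover have "closed ({v :: nat \<Rightarrow> real. (\<Sum>i\<in>{1..N}. v i) = 0} \<inter> {v. (\<Sum>i\<in>{1..N}. (v i)\<^sup>2) = 1})"
    by (intro closed_Int closed_Collect_eq continuous_intros continuous_on_product_coordinates)
  ultimately have "compact (Pi\<^sub>E UNIV K \<inter> ({v :: nat \<Rightarrow> real. (\<Sum>i\<in>{1..N}. v i) = 0} \<inter> {v. (\<Sum>i\<in>{1..N}. (v i)\<^sup>2) = 1}))"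
    by (rule compact_Int_closed)
  moreover have "?S = Pi\<^sub>E UNIV K \<inter> ({v :: nat \<Rightarrow> real. (\<Sum>i\<in>{1..N}. v i) = 0} \<inter> {v. (\<Sum>i\<in>{1..N}. (v i)\<^sup>2) = 1})"
  proof -
    have "v i \<in> K i" if "v \<in> ?S" for v i
    proof (cases "i \<in> {1..N}")
      case True
      then have "(v i)\<^sup>2 \<le> (\<Sum>i\<in>{1..N}. (v i)\<^sup>2)" by (intro member_le_sum) auto
      then have "(v i)\<^sup>2 \<le> 1" using that by simp
      then show ?thesis using True by (simp add: K_def abs_square_le_1 abs_le_iff)
    qed (use that in \<open>auto simp: K_def\<close>)
    moreover have "v i = 0" if "v \<in> Pi\<^sub>E UNIV K" "i \<notin> {1..N}" for v i
      using PiE_mem[OF that(1), of i] that(2) by (auto simp: K_def)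
    ultimately show ?thesis by (auto simp: PiE_UNIV_domain)
  qed
  ultimately show ?thesis by simp
qed

text \<open>The minimum \<open>m\<close> of the form on the sphere bounds the form from below by
  homogeneity, and stationarity turns the minimiser into an eigenvector. It is positive because a
  sum-zero vector of zero form is constant, hence zero.\<close>

lemma laplacian_min_eigenvalue:
  assumes G: "undirected_graph N Nb" and conn: "graph_connected N Nb" and N: "N \<ge> 2"
  shows "\<exists>m>0. poly (char_poly (lap_mat N Nb)) m = 0 \<and>
    (\<forall>u :: nat \<Rightarrow> real. (\<Sum>i\<in>{1..N}. u i) = 0 \<longrightarrow>
       m * (\<Sum>i\<in>{1..N}. (u i)\<^sup>2) \<le> (\<Sum>i\<in>{1..N}. u i * (\<Sum>j\<in>Nb i. u i - u j)))"
proof -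
  define S where "S = {v :: nat \<Rightarrow> real. (\<forall>i. i \<notin> {1..N} \<longrightarrow> v i = 0) \<and>
     (\<Sum>i\<in>{1..N}. v i) = 0 \<and> (\<Sum>i\<in>{1..N}. (v i)\<^sup>2) = 1}"
  define B where "B u w = (\<Sum>i\<in>{1..N}. u i * (\<Sum>j\<in>Nb i. w i - w j))" for u w :: "nat \<Rightarrow> real"
  have Bp: "B u w = (\<Sum>p\<in>pairs N Nb. (u (fst p) - u (snd p)) * (w (fst p) - w (snd p))) / 2" for u w
    unfolding B_def by (rule laplacian_form[OF G])
  note inN = pairs_in[OF G]
  have "compact S" unfolding S_def by (rule compact_sphere_sum_zero)
  moreover have "S \<noteq> {}"
  proof -
    \<comment> \<open>The sphere is inhabited because there are at least two vertices.\<close>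
    define v :: "nat \<Rightarrow> real" where
      "v i = (if i = 1 then 1 / sqrt 2 else 0) + (if i = 2 then - 1 / sqrt 2 else 0)" for i
    have v2: "(v i)\<^sup>2 = (if i = 1 then 1 / 2 else 0) + (if i = 2 then 1 / 2 else 0)" for i
      by (simp add: v_def power_divide)
    have "v \<in> S" using N unfolding S_def mem_Collect_eq v2 
      by (auto simp: v_def sum.distrib)
    then show ?thesis by blast
  qed
  moreover have "continuous_on S (\<lambda>v. B v v)"
    unfolding B_def by (intro continuous_intros continuous_on_subset[OF continuous_on_product_coordinates]) auto
  ultimately obtain v where v: "v \<in> S" and vmin: "\<And>w. w \<in> S \<Longrightarrow> B v v \<le> B w w"
    using continuous_attains_inf[of S "\<lambda>v. B v v"] by blast
  define m where "m = B v v"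
  have le: "m * (\<Sum>i\<in>{1..N}. (u i)\<^sup>2) \<le> B u u" if u: "(\<Sum>i\<in>{1..N}. u i) = 0" for u
  proof (cases "(\<Sum>i\<in>{1..N}. (u i)\<^sup>2) = 0")
    case True
    then show ?thesis using laplacian_form_nonneg[OF G, of u] by (simp add: B_def)
  next
    case False
    define s where "s = (\<Sum>i\<in>{1..N}. (u i)\<^sup>2)"
    have s: "s > 0" using False sum_nonneg[of "{1..N}" "\<lambda>i. (u i)\<^sup>2"] by (simp add: s_def less_le)
    define w where "w i = (if i \<in> {1..N} then u i / sqrt s else 0)" for i
    have "(\<Sum>i\<in>{1..N}. w i) = (\<Sum>i\<in>{1..N}. u i) / sqrt s"
      unfolding sum_divide_distrib by (intro sum.cong) (auto simp: w_def)
    moreover have "(\<Sum>i\<in>{1..N}. (w i)\<^sup>2) = (\<Sum>i\<in>{1..N}. (u i)\<^sup>2) / s"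
      unfolding sum_divide_distrib using s by (intro sum.cong) (auto simp: w_def power_divide)
    ultimately have "w \<in> S" using u s by (auto simp: S_def s_def w_def)
    then have "m \<le> B w w" using vmin by (simp add: m_def)
    also have "B w w = B u u / s"
    proof -
      have "(w (fst p) - w (snd p)) * (w (fst p) - w (snd p)) = (u (fst p) - u (snd p)) * (u (fst p) - u (snd p)) / s"
        if "p \<in> pairs N Nb" for p
        using inN[OF that] s by (simp add: w_def diff_divide_distrib[symmetric])
      then show ?thesis unfolding Bp by (simp add: sum_divide_distrib[symmetric])
    qed
    finally show ?thesis using s unfolding s_def[symmetric] by (simp add: field_simps)
  qed
  have vS: "(\<Sum>i\<in>{1..N}. v i) = 0" "(\<Sum>i\<in>{1..N}. (v i)\<^sup>2) = 1" using v by (auto simp: S_def)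
  have mpos: "m > 0"
  proof (rule ccontr)
    assume "\<not> m > 0"
    then have "B v v = 0" using laplacian_form_nonneg[OF G, of v] by (simp add: m_def B_def)
    then have "v i = v 1" if "i \<in> {1..N}" for i
      using laplacian_form_zero_const[OF G conn, of v i 1] that N by (simp add: B_def)
    then have "(\<Sum>i\<in>{1..N}. v i) = (\<Sum>i\<in>{1..N}. v 1)" "(\<Sum>i\<in>{1..N}. (v i)\<^sup>2) = (\<Sum>i\<in>{1..N}. (v 1)\<^sup>2)"
      by (auto simp only: intro!: sum.cong)
    then show False using vS N by auto
  qed
  define e where "e i = (\<Sum>j\<in>Nb i. v i - v j) - m * v i" for i
  have e0: "(\<Sum>i\<in>{1..N}. e i) = 0"
    using laplacian_sum_zero[OF G, of v] vS(1) by (simp add: e_def sum_subtractf sum_distrib_left[symmetric])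
  have ev: "B e v - m * (\<Sum>i\<in>{1..N}. e i * v i) = (\<Sum>i\<in>{1..N}. (e i)\<^sup>2)"
  proof -
    have "(\<Sum>i\<in>{1..N}. (e i)\<^sup>2) = (\<Sum>i\<in>{1..N}. e i * (\<Sum>j\<in>Nb i. v i - v j) - m * (e i * v i))"
      by (intro sum.cong refl) (simp add: e_def power2_eq_square algebra_simps)
    then show ?thesis unfolding B_def by (simp add: sum_subtractf sum_distrib_left)
  qed
  \<comment> \<open>The residual \<open>e\<close> has sum zero, so \<open>v + t * e\<close> is
    admissible for every \<open>t\<close>. The form minus \<open>m\<close> times the square norm is
    then a nonnegative quadratic in \<open>t\<close> vanishing at 0, so its linear coefficient is
    zero. By \<open>ev\<close> that coefficient is twice the square norm of the residual.\<close>
  have "B e v - m * (\<Sum>i\<in>{1..N}. e i * v i) = 0"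
  proof (rule quadratic_nonneg_linear_zero)
    show "B e e - m * (\<Sum>i\<in>{1..N}. (e i)\<^sup>2) \<ge> 0" using le[OF e0] by simp
    fix t :: real
    define w where "w i = v i + t * e i" for i
    have "(\<Sum>i\<in>{1..N}. w i) = 0"
      using vS(1) e0 by (simp add: w_def sum.distrib sum_distrib_left[symmetric])
    then have "B w w - m * (\<Sum>i\<in>{1..N}. (w i)\<^sup>2) \<ge> 0" using le by simp
    moreover have "B w w = B v v + 2 * t * B e v + t\<^sup>2 * B e e"
      unfolding Bp w_def
      by (simp add: sum_divide_distrib sum_distrib_left sum.distrib[symmetric])
        (intro sum.cong refl, simp add: power2_eq_square algebra_simps add_divide_distrib diff_divide_distrib)
    moreover have "(\<Sum>i\<in>{1..N}. (w i)\<^sup>2)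
        = (\<Sum>i\<in>{1..N}. (v i)\<^sup>2) + 2 * t * (\<Sum>i\<in>{1..N}. e i * v i) + t\<^sup>2 * (\<Sum>i\<in>{1..N}. (e i)\<^sup>2)"
      by (simp add: w_def sum_distrib_left sum.distrib[symmetric] power2_eq_square algebra_simps)
    ultimately show "2 * t * (B e v - m * (\<Sum>i\<in>{1..N}. e i * v i)) + t\<^sup>2 * (B e e - m * (\<Sum>i\<in>{1..N}. (e i)\<^sup>2)) \<ge> 0"
      using vS(2) by (simp add: m_def[symmetric] algebra_simps)
  qed
  then have "\<forall>i\<in>{1..N}. (e i)\<^sup>2 = 0"
    unfolding ev by (subst (asm) sum_nonneg_eq_0_iff) auto
  then have "\<forall>i\<in>{1..N}. (\<Sum>j\<in>Nb i. v i - v j) = m * v i" by (auto simp: e_def)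
  moreover have "\<exists>i\<in>{1..N}. v i \<noteq> 0"
    by (rule ccontr) (use vS(2) in auto)
  ultimately have "poly (char_poly (lap_mat N Nb)) m = 0"
    using char_poly_lap_root_iff[OF G] by blast
  then show ?thesis using mpos le unfolding B_def by (intro exI[of _ m] conjI allI impI)
qed

text \<open>The minimal value \<open>m\<close> of the form is a positive root, so
  \<open>lambda2 N Nb\<close> is positive and at most \<open>m\<close>; lowering \<open>m\<close> to
  \<open>lambda2 N Nb\<close> preserves the lower bound on the form.\<close>

lemma lambda2_bounds:
  fixes u :: "nat \<Rightarrow> real"
  assumes "undirected_graph N Nb" "graph_connected N Nb" "N \<ge> 2"
  shows lambda2_pos: "lambda2 N Nb > 0"
    and lambda2_form_le: "(\<Sum>i\<in>{1..N}. u i) = 0 \<Longrightarrow>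
      lambda2 N Nb * (\<Sum>i\<in>{1..N}. (u i)\<^sup>2) \<le> (\<Sum>i\<in>{1..N}. u i * (\<Sum>j\<in>Nb i. u i - u j))"
proof -
  obtain m where m: "m > 0" "poly (char_poly (lap_mat N Nb)) m = 0"
    and le: "\<forall>u :: nat \<Rightarrow> real. (\<Sum>i\<in>{1..N}. u i) = 0 \<longrightarrow>
       m * (\<Sum>i\<in>{1..N}. (u i)\<^sup>2) \<le> (\<Sum>i\<in>{1..N}. u i * (\<Sum>j\<in>Nb i. u i - u j))"
    using laplacian_min_eigenvalue[OF assms] by (elim exE conjE)
  have N1: "N \<ge> 1" using assms(3) by simp
  note l2 = lambda2_props[OF assms(1,2) N1 m(2,1)]
  show "lambda2 N Nb > 0" by (rule l2(1))
  assume "(\<Sum>i\<in>{1..N}. u i) = 0"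
  then have "m * (\<Sum>i\<in>{1..N}. (u i)\<^sup>2) \<le> (\<Sum>i\<in>{1..N}. u i * (\<Sum>j\<in>Nb i. u i - u j))"
    using le by (elim allE impE)
  moreover have "lambda2 N Nb * (\<Sum>i\<in>{1..N}. (u i)\<^sup>2) \<le> m * (\<Sum>i\<in>{1..N}. (u i)\<^sup>2)"
    by (intro mult_right_mono l2(2) sum_nonneg) simp
  ultimately show "lambda2 N Nb * (\<Sum>i\<in>{1..N}. (u i)\<^sup>2) \<le> (\<Sum>i\<in>{1..N}. u i * (\<Sum>j\<in>Nb i. u i - u j))"
    by linarith
qed

section \<open>Spectral norms\<close>

text \<open>By Cauchy-Schwarz the Frobenius norm bounds every value. Boundedness is what makes the
  supremum in \<open>spec_norm\<close> an upper bound of its set.\<close>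

lemma spec_norm_bdd:
  assumes "finite R" "finite C"
  shows "bdd_above {sqrt (\<Sum>r \<in> R. (\<Sum>c \<in> C. A r c * v c)\<^sup>2) | v. (\<Sum>c \<in> C. (v c)\<^sup>2) = (1 :: real)}"
proof (rule bdd_aboveI)
  fix x assume "x \<in> {sqrt (\<Sum>r \<in> R. (\<Sum>c \<in> C. A r c * v c)\<^sup>2) | v. (\<Sum>c \<in> C. (v c)\<^sup>2) = (1 :: real)}"
  then obtain v where x: "x = sqrt (\<Sum>r \<in> R. (\<Sum>c \<in> C. A r c * v c)\<^sup>2)" and v: "(\<Sum>c \<in> C. (v c)\<^sup>2) = 1"
    by blast
  have "(\<Sum>c \<in> C. A r c * v c)\<^sup>2 \<le> (\<Sum>c \<in> C. (A r c)\<^sup>2)" for r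
    using Cauchy_Schwarz_ineq_sum[of "A r" v C] v by simp
  then show "x \<le> sqrt (\<Sum>r \<in> R. \<Sum>c \<in> C. (A r c)\<^sup>2)"
    unfolding x by (intro real_sqrt_le_mono sum_mono)
qed

lemma spec_norm_sq_bound:
  assumes "finite R" "finite C"
  shows "(\<Sum>r\<in>R. (\<Sum>c\<in>C. A r c * v c)\<^sup>2) \<le> (spec_norm R C A)\<^sup>2 * (\<Sum>c\<in>C. (v c)\<^sup>2)"
proof (cases "(\<Sum>c\<in>C. (v c)\<^sup>2) = 0")
  case True
  then have "\<forall>c\<in>C. v c = 0" using assms(2) by (subst (asm) sum_nonneg_eq_0_iff) auto
  then show ?thesis using True by simp
next
  case False
  define s where "s = (\<Sum>c\<in>C. (v c)\<^sup>2)"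
  have s: "s > 0" using False sum_nonneg[of C "\<lambda>i. (v i)\<^sup>2"] by (simp add: s_def less_le)
  define w where "w c = v c / sqrt s" for c
  have "(\<Sum>c\<in>C. (w c)\<^sup>2) = 1"
    using s by (simp add: w_def power_divide sum_divide_distrib[symmetric] s_def[symmetric])
  then have "sqrt (\<Sum>r \<in> R. (\<Sum>c \<in> C. A r c * w c)\<^sup>2) \<le> spec_norm R C A"
    unfolding spec_norm_def by (intro cSup_upper spec_norm_bdd[OF assms]) blast
  moreover have "(\<Sum>r \<in> R. (\<Sum>c \<in> C. A r c * w c)\<^sup>2) = (\<Sum>r \<in> R. (\<Sum>c \<in> C. A r c * v c)\<^sup>2) / s"
    using s by (simp add: w_def power_divide sum_divide_distrib[symmetric])
  ultimately have "(\<Sum>r \<in> R. (\<Sum>c \<in> C. A r c * v c)\<^sup>2) / s \<le> (spec_norm R C A)\<^sup>2"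
    by (intro sqrt_le_D) simp
  then show ?thesis using s by (simp add: s_def[symmetric] field_simps)
qed

text \<open>A nonempty column set provides a unit vector; without one the supremum would be taken
  over the empty set.\<close>

lemma spec_norm_nonneg:
  assumes "finite R" "finite C" "C \<noteq> {}"
  shows "spec_norm R C A \<ge> 0"
proof -
  obtain c0 where c0: "c0 \<in> C" using assms by blast
  define w :: "'b \<Rightarrow> real" where "w c = (if c = c0 then 1 else 0)" for c
  have "(\<Sum>c\<in>C. (w c)\<^sup>2) = (\<Sum>c\<in>C. if c = c0 then 1 else 0)" by (intro sum.cong) (auto simp: w_def)
  then have "(\<Sum>c\<in>C. (w c)\<^sup>2) = 1" using c0 assms by simp
  then have "sqrt (\<Sum>r \<in> R. (\<Sum>c \<in> C. A r c * w c)\<^sup>2) \<le> spec_norm R C A"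
    unfolding spec_norm_def by (intro cSup_upper spec_norm_bdd[OF assms(1,2)]) blast
  moreover have "0 \<le> sqrt (\<Sum>r \<in> R. (\<Sum>c \<in> C. A r c * w c)\<^sup>2)" by (simp add: sum_nonneg)
  ultimately show ?thesis by linarith
qed

lemma spec_norm_bilinear:
  fixes u :: "'r \<Rightarrow> real"
  assumes "finite R" "finite C" "C \<noteq> {}"
  shows "\<bar>\<Sum>r\<in>R. u r * (\<Sum>c\<in>C. A r c * v c)\<bar>
    \<le> spec_norm R C A * (sqrt (\<Sum>r\<in>R. (u r)\<^sup>2) * sqrt (\<Sum>c\<in>C. (v c)\<^sup>2))"
proof -
  have "(\<Sum>r\<in>R. u r * (\<Sum>c\<in>C. A r c * v c))\<^sup>2 \<le> (\<Sum>r\<in>R. (u r)\<^sup>2) * (\<Sum>r\<in>R. (\<Sum>c\<in>C. A r c * v c)\<^sup>2)"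
    by (rule Cauchy_Schwarz_ineq_sum)
  also have "\<dots> \<le> (\<Sum>r\<in>R. (u r)\<^sup>2) * ((spec_norm R C A)\<^sup>2 * (\<Sum>c\<in>C. (v c)\<^sup>2))"
    by (intro mult_left_mono spec_norm_sq_bound assms sum_nonneg) auto
  finally have "\<bar>\<Sum>r\<in>R. u r * (\<Sum>c\<in>C. A r c * v c)\<bar>
      \<le> sqrt ((\<Sum>r\<in>R. (u r)\<^sup>2) * ((spec_norm R C A)\<^sup>2 * (\<Sum>c\<in>C. (v c)\<^sup>2)))"
    unfolding real_sqrt_abs[symmetric] by (rule real_sqrt_le_mono)
  then show ?thesis using spec_norm_nonneg[OF assms, of A]
    by (simp add: real_sqrt_mult mult_ac)
qed

text \<open>The bilinear bound followed by 2 x y <= k x^2 + y^2 / k. The weight \<open>k\<close>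
  stays free; both later uses take it to be lambda2 / lambdaG.\<close>

lemma spec_norm_young:
  fixes u :: "'r \<Rightarrow> real"
  assumes "finite R" "finite C" "C \<noteq> {}" "k > 0"
  shows "2 * (\<Sum>r\<in>R. u r * (\<Sum>c\<in>C. A r c * v c))
    \<le> k * (spec_norm R C A)\<^sup>2 * (\<Sum>r\<in>R. (u r)\<^sup>2) + (\<Sum>c\<in>C. (v c)\<^sup>2) / k"
proof -
  define a where "a = sqrt (\<Sum>r\<in>R. (u r)\<^sup>2)"
  define b where "b = sqrt (\<Sum>c\<in>C. (v c)\<^sup>2)"
  define s where "s = spec_norm R C A"
  have ab: "a\<^sup>2 = (\<Sum>r\<in>R. (u r)\<^sup>2)" "b\<^sup>2 = (\<Sum>c\<in>C. (v c)\<^sup>2)"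
    by (auto simp: a_def b_def sum_nonneg)
  have "k * s\<^sup>2 * a\<^sup>2 + b\<^sup>2 / k - 2 * (s * (a * b)) = (k * s * a - b)\<^sup>2 / k"
    using assms(4) by (simp add: field_simps power2_eq_square)
  also have "\<dots> \<ge> 0" using assms(4) by simp
  finally have "2 * (s * (a * b)) \<le> k * s\<^sup>2 * a\<^sup>2 + b\<^sup>2 / k" by simp
  then show ?thesis
    using spec_norm_bilinear[OF assms(1-3), of u A v]
    unfolding ab[symmetric] s_def[symmetric] by (simp add: a_def b_def sum_nonneg)
qed

section \<open>The matrices W, Q and J acting on vectors, and positivity of lambdaG\<close>

lemma matprod_apply:
  assumes "finite S" "finite C"
  shows "(\<Sum>c\<in>C. matprod S A B r c * v c) = (\<Sum>s\<in>S. A r s * (\<Sum>c\<in>C. B s c * v c))"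
  unfolding matprod_def sum_distrib_right sum_distrib_left
  by (subst sum.swap) (simp add: mult.assoc)

lemma Wmat_apply:
  assumes "undirected_graph N Nb" "i \<in> {1..N}"
  shows "(\<Sum>p\<in>pairs N Nb. Wmat i p * e p) = (\<Sum>j\<in>Nb i. e (i, j))"
proof -
  have "(\<Sum>p\<in>pairs N Nb. Wmat i p * e p) = (\<Sum>k\<in>{1..N}. \<Sum>j\<in>Nb k. (if k = i then e (k, j) else 0))"
    using sum_pairs[OF assms(1), of "\<lambda>k j. Wmat i (k, j) * e (k, j)"] 
    by (simp add: Wmat_def if_distrib[of "\<lambda>z. z * _"] cong: if_cong)
  also have "\<dots> = (\<Sum>k\<in>{1..N}. if k = i then \<Sum>j\<in>Nb k. e (k, j) else 0)"
    by (intro sum.cong) auto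
  finally show ?thesis using assms(2) by simp
qed

lemma Qmat_apply:
  assumes "undirected_graph N Nb" "p \<in> pairs N Nb"
  shows "(\<Sum>s\<in>{1..N}. Qmat p s * g s) = g (snd p)"
proof -
  have "(\<Sum>s\<in>{1..N}. Qmat p s * g s) = (\<Sum>s\<in>{1..N}. if s = snd p then g s else 0)"
    by (intro sum.cong) (auto simp: Qmat_def)
  moreover have "snd p \<in> {1..N}" using pairs_in[OF assms] by simp
  ultimately show ?thesis by simp
qed

lemma Jmat_apply:
  assumes "r \<in> {1..N}"
  shows "(\<Sum>s\<in>{1..N}. Jmat N r s * g s) = g r - (\<Sum>s\<in>{1..N}. g s) / real N"
proof -
  have "(\<Sum>s\<in>{1..N}. Jmat N r s * g s) = (\<Sum>s\<in>{1..N}. (if s = r then g s else 0) - g s / real N)"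
    by (intro sum.cong) (auto simp: Jmat_def algebra_simps)
  then show ?thesis using assms by (simp add: sum_subtractf sum_divide_distrib)
qed

lemma pairs_nonempty:
  assumes "undirected_graph N Nb" "graph_connected N Nb" "N \<ge> 2"
  shows "pairs N Nb \<noteq> {}"
proof -
  have "(1, 2) \<in> (graph_edges N Nb)\<^sup>*" using assms by (auto simp: graph_connected_def)
  then have "graph_edges N Nb \<noteq> {}" by (metis converse_rtranclE empty_iff one_eq_numeral_iff semiring_norm(83))
  then show ?thesis by (simp add: graph_edges_def pairs_def)
qed

text \<open>Test vector: the indicator of one pair (i, j). W sends it to the unit vector at i, whose
  entry i after centring by J is 1 - 1/N, nonzero since N >= 2. Positivity matters because
  \<open>lambdaG\<close> is a divisor in \<open>alpha_const\<close>.\<close>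

lemma lambdaG_pos:
  assumes G: "undirected_graph N Nb" and "graph_connected N Nb" and N: "N \<ge> 2"
  shows "lambdaG N Nb > 0"
proof -
  obtain i j where p: "(i, j) \<in> pairs N Nb" using pairs_nonempty[OF assms] by auto
  then have i: "i \<in> {1..N}" and j: "j \<in> Nb i" by (auto simp: pairs_def)
  define v :: "nat \<times> nat \<Rightarrow> real" where "v p = (if p = (i, j) then 1 else 0)" for p
  have "(\<Sum>j'\<in>Nb r. v (r, j')) = (if r = i then 1 else 0)" if "r \<in> {1..N}" for r
    using that j graph_finite_Nb[OF G that] by (auto simp: v_def)
  then have W: "(\<Sum>p\<in>pairs N Nb. Wmat r p * v p) = (if r = i then 1 else 0)" if "r \<in> {1..N}" for r
    using Wmat_apply[OF G that] that by simp
  have "(\<Sum>c\<in>pairs N Nb. matprod {1..N} (Jmat N) Wmat i c * v c) = 1 - 1 / real N"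
  proof -
    have "(\<Sum>c\<in>pairs N Nb. matprod {1..N} (Jmat N) Wmat i c * v c)
        = (\<Sum>s\<in>{1..N}. Jmat N i s * (if s = i then 1 else 0))"
      unfolding matprod_apply[OF finite_atLeastAtMost finite_pairs[OF G]]
      by (intro sum.cong refl) (simp only: W)
    then show ?thesis using i Jmat_apply[OF i, of "\<lambda>r. if r = i then 1 else 0"] by simp
  qed
  then have "(1 - 1 / real N)\<^sup>2 \<le> (\<Sum>r\<in>{1..N}. (\<Sum>c\<in>pairs N Nb. matprod {1..N} (Jmat N) Wmat r c * v c)\<^sup>2)"
    using i member_le_sum[of i "{1..N}" "\<lambda>r. (\<Sum>c\<in>pairs N Nb. matprod {1..N} (Jmat N) Wmat r c * v c)\<^sup>2"] by simp
  also have "\<dots> \<le> lambdaG N Nb * (\<Sum>c\<in>pairs N Nb. (v c)\<^sup>2)"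
    unfolding lambdaG_def by (rule spec_norm_sq_bound) (auto simp: finite_pairs[OF G])
  finally have le: "(1 - 1 / real N)\<^sup>2 \<le> lambdaG N Nb * (\<Sum>c\<in>pairs N Nb. (v c)\<^sup>2)" .
  have "(1 - 1 / real N)\<^sup>2 > 0" using N by simp
  moreover have "lambdaG N Nb \<ge> 0" by (simp add: lambdaG_def)
  ultimately show ?thesis using le by (cases "lambdaG N Nb = 0") auto
qed

section \<open>Stochastic approximation recursions\<close>

text \<open>Induction with the ansatz K / t. Inserting it into the recursion leaves a surplus of K
  (\<kappa> - 1) / (t (t + 1)) below K / (t + 1), positive since \<kappa> > 1, and this absorbs C /
  (t + 1)^2.\<close>

lemma recursion_rate:
  fixes U :: "nat \<Rightarrow> real"
  assumes rec: "\<And>t. t \<ge> T \<Longrightarrow> U (Suc t) \<le> (1 - \<kappa> / real (Suc t)) * U t + C / (real (Suc t))\<^sup>2"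
    and T: "T \<ge> 1" and \<kappa>: "\<kappa> > 1" and C: "C \<ge> 0"
  shows "\<exists>K>0. \<forall>t\<ge>T. U t \<le> K / real t"
proof -
  \<comment> \<open>From \<open>T1\<close> on the factor \<open>1 - \<kappa> / real (Suc t)\<close>
    is nonnegative, so the induction hypothesis may be multiplied by it.\<close>
  define T1 where "T1 = max (max T 1) (nat \<lceil>\<kappa>\<rceil>)"
  have T1: "T1 \<ge> T" "T1 \<ge> 1" "real T1 \<ge> \<kappa>" by (auto simp: T1_def le_max_iff_disj) linarith+
  \<comment> \<open>The first entry gives C <= K (\<kappa> - 1), the second covers the finitely many
    times up to \<open>T1\<close>, and adding 1 makes \<open>K\<close> positive.\<close>
  define K where "K = max (C / (\<kappa> - 1)) (Max ((\<lambda>t. real t * U t) ` {T..T1})) + 1"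
  have K1: "K \<ge> C / (\<kappa> - 1)" by (simp add: K_def)
  have K2: "real t * U t \<le> K" if "t \<in> {T..T1}" for t
  proof -
    have "real t * U t \<le> Max ((\<lambda>t. real t * U t) ` {T..T1})" using that by (intro Max_ge) auto
    then show ?thesis by (simp add: K_def)
  qed
  have "C / (\<kappa> - 1) \<ge> 0" using C \<kappa> by simp
  then have K0: "K > 0" by (simp add: K_def)
  have big: "U t \<le> K / real t" if "t \<ge> T1" for t
    using that
  proof (induction t rule: dec_induct)
    case base
    then show ?case using K2[of T1] T1 by (simp add: field_simps)
  next
    case (step t)
    define s where "s = real t"
    have s: "s \<ge> 1" "s \<ge> \<kappa>" using step T1 by (auto simp: s_def)
    have "U (Suc t) \<le> (1 - \<kappa> / (s + 1)) * U t + C / (s + 1)\<^sup>2"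
      using rec[of t] step T1 by (simp add: s_def add.commute)
    also have "\<dots> \<le> (1 - \<kappa> / (s + 1)) * (K / s) + C / (s + 1)\<^sup>2"
      using step.IH s \<kappa> by (intro add_right_mono mult_left_mono) (auto simp: s_def field_simps)
    also have "\<dots> \<le> K / (s + 1)"
    proof -
      have "C \<le> K * (\<kappa> - 1)" using K1 \<kappa> by (simp add: field_simps)
      then have "C / (s + 1)\<^sup>2 \<le> K * (\<kappa> - 1) / (s + 1)\<^sup>2" by (simp add: divide_right_mono)
      also have "\<dots> \<le> K * (\<kappa> - 1) / (s * (s + 1))"
        using K0 \<kappa> s by (intro divide_left_mono) (auto simp: power2_eq_square)
      also have "\<dots> = K / (s + 1) - (1 - \<kappa> / (s + 1)) * (K / s)"
        using s by (simp add: divide_simps) (simp add: algebra_simps)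
      finally show ?thesis by simp
    qed
    finally show ?case by (simp add: s_def add.commute)
  qed
  have "U t \<le> K / real t" if "t \<ge> T" for t
    using big[of t] K2[of t] that T by (cases "t \<ge> T1") (auto simp: field_simps)
  then show ?thesis using K0 by blast
qed

text \<open>A correction of order 1/t makes the recursion homogeneous. The product of its factors is
  then at most a constant times exp (- k \<open>harm t\<close>), and the harmonic numbers
  diverge.\<close>

lemma recursion_tendsto_zero:
  fixes U :: "nat \<Rightarrow> real"
  assumes rec: "\<And>t. t \<ge> T \<Longrightarrow> U (Suc t) \<le> (1 - \<kappa> / real (Suc t)) * U t + C / (real (Suc t))\<^sup>2"
    and U0: "\<And>t. t \<ge> T \<Longrightarrow> U t \<ge> 0" and \<kappa>: "\<kappa> > 0" and C: "C \<ge> 0"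
  shows "U \<longlonglongrightarrow> 0"
proof -
  define k where "k = min \<kappa> (1 / 2)"
  have k: "k > 0" "k \<le> 1 / 2" "k \<le> \<kappa>" using \<kappa> by (auto simp: k_def)
  define T1 where "T1 = max T 1"
  have T1: "T1 \<ge> T" "T1 \<ge> 1" by (auto simp: T1_def)
  \<comment> \<open>Under the factor 1 - k / (t + 1) the correction leaves a surplus of 2 C (1 - k)
    / (t (t + 1)). Since \<open>k\<close> is at most 1/2, this is at least C / (t (t + 1)) and
    dominates the perturbation.\<close>
  define Z where "Z t = U t + 2 * C / real t" for t
  have Z0: "Z t \<ge> 0" if "t \<ge> T1" for t using U0[of t] that T1 C by (simp add: Z_def)
  have Zrec: "Z (Suc t) \<le> (1 - k / real (Suc t)) * Z t" if t: "t \<ge> T1" for t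
  proof -
    define s where "s = real t"
    have s: "s \<ge> 1" using t T1 by (simp add: s_def)
    have "U (Suc t) \<le> (1 - \<kappa> / (s + 1)) * U t + C / (s + 1)\<^sup>2"
      using rec[of t] t T1 by (simp add: s_def add.commute)
    also have "\<dots> \<le> (1 - k / (s + 1)) * U t + C / (s + 1)\<^sup>2"
      using U0[of t] t T1 k s by (intro add_right_mono mult_right_mono) (auto simp: divide_right_mono)
    finally have "U (Suc t) + 2 * C / (s + 1) \<le> (1 - k / (s + 1)) * U t + (C / (s + 1)\<^sup>2 + 2 * C / (s + 1))" by simp
    also have "C / (s + 1)\<^sup>2 + 2 * C / (s + 1) \<le> (1 - k / (s + 1)) * (2 * C / s)"
    proof -
      have "C / (s + 1)\<^sup>2 \<le> C / (s * (s + 1))"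
        using C s by (intro divide_left_mono) (auto simp: power2_eq_square)
      also have "\<dots> \<le> (2 * (1 - k)) * (C / (s * (s + 1)))"
        using k C s mult_right_mono[of 1 "2 * (1 - k)" "C / (s * (s + 1))"] by simp
      also have "\<dots> = (1 - k / (s + 1)) * (2 * C / s) - 2 * C / (s + 1)"
        using s by (simp add: divide_simps) (simp add: algebra_simps)
      finally show ?thesis by simp
    qed
    finally show ?thesis by (simp add: Z_def s_def algebra_simps)
  qed
  have bound: "Z t \<le> Z T1 * exp (k * harm T1) * exp (- k * harm t)" if "t \<ge> T1" for t
    using that
  proof (induction t rule: dec_induct)
    case base
    have "exp (k * harm T1) * exp (- k * harm T1) = 1" by (simp add: exp_add[symmetric])
    then show ?case by (simp add: mult.assoc)
  next
    case (step t)
    have "Z (Suc t) \<le> (1 - k / real (Suc t)) * Z t" using Zrec step by simp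
    also have "\<dots> \<le> exp (- (k / real (Suc t))) * Z t"
      using Z0 step exp_ge_add_one_self[of "- (k / real (Suc t))"] by (intro mult_right_mono) auto
    also have "\<dots> \<le> exp (- (k / real (Suc t))) * (Z T1 * exp (k * harm T1) * exp (- k * harm t))"
      using step.IH by (intro mult_left_mono) auto
    also have "\<dots> = Z T1 * exp (k * harm T1) * exp (- k * harm (Suc t))"
    proof -
      have "- k * harm (Suc t) = - (k / real (Suc t)) + - k * harm t"
        by (simp add: harm_Suc algebra_simps inverse_eq_divide)
      then have "exp (- k * harm (Suc t)) = exp (- (k / real (Suc t))) * exp (- k * harm t)"
        by (simp only: exp_add)
      then show ?thesis by simp
    qed
    finally show ?case .
  qed
  have "filterlim (\<lambda>t. k * harm t) at_top sequentially"
    using harm_at_top k(1) by (intro filterlim_tendsto_pos_mult_at_top[OF tendsto_const])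
  then have "filterlim (\<lambda>t. - k * harm t) at_bot sequentially"
    by (simp add: filterlim_uminus_at_top)
  then have "(\<lambda>t. exp (- k * harm t)) \<longlonglongrightarrow> 0"
    by (rule filterlim_compose[OF exp_at_bot])
  then have lim: "(\<lambda>t. Z T1 * exp (k * harm T1) * exp (- k * harm t)) \<longlonglongrightarrow> 0"
    by (rule tendsto_mult_right_zero)
  show ?thesis
  proof (rule tendsto_sandwich[OF _ _ tendsto_const lim])
    show "eventually (\<lambda>t. 0 \<le> U t) sequentially"
      using U0 eventually_sequentially by blast
    have "U t \<le> Z T1 * exp (k * harm T1) * exp (- k * harm t)" if "t \<ge> T1" for t
    proof -
      have "U t \<le> Z t" using C by (simp add: Z_def)
      then show ?thesis using bound[OF that] by linarith
    qed
    then show "eventually (\<lambda>t. U t \<le> Z T1 * exp (k * harm T1) * exp (- k * harm t)) sequentially"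
      using eventually_sequentially by blast
  qed
qed

text \<open>The Lyapunov function is \<open>p V + R\<close>, with \<open>p\<close> chosen slightly above the value at which
  the coefficient of \<open>V\<close> in the drift equals \<open>- \<kappa>0 p\<close>.\<close>

lemma coupled_lyapunov:
  fixes V R :: "nat \<Rightarrow> real"
  assumes V: "\<And>t. t \<ge> T \<Longrightarrow> V (Suc t) \<le> V t + (- av * V t + q * R t) / real (Suc t) + C / (real (Suc t))\<^sup>2"
    and R: "\<And>t. t \<ge> T \<Longrightarrow> R (Suc t) \<le> R t + (q * V t - ar * R t) / real (Suc t) + C / (real (Suc t))\<^sup>2"
    and V0: "\<And>t. t \<ge> T \<Longrightarrow> V t \<ge> 0" and R0: "\<And>t. t \<ge> T \<Longrightarrow> R t \<ge> 0"
    and q: "q > 0" and C: "C \<ge> 0" and av: "av > \<kappa>0" and ar: "ar > q\<^sup>2 / (av - \<kappa>0) + \<kappa>0"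
  obtains p \<kappa> where "p > 0" "\<kappa> > \<kappa>0"
    "\<And>t. t \<ge> T \<Longrightarrow> p * V (Suc t) + R (Suc t)
       \<le> (1 - \<kappa> / real (Suc t)) * (p * V t + R t) + ((p + 1) * C) / (real (Suc t))\<^sup>2"
proof -
  define g where "g = ar - \<kappa>0 - q\<^sup>2 / (av - \<kappa>0)"
  have g: "g > 0" using ar by (simp add: g_def)
  \<comment> \<open>The gap \<open>g\<close> is shared out: any excess of \<open>p\<close> over
    \<open>q / (av - \<kappa>0)\<close> makes the decay rate of \<open>V\<close> exceed
    \<open>\<kappa>0\<close>, and an excess of \<open>g / (2 * q)\<close> costs the rate of
    \<open>R\<close> only half of its gap.\<close>
  define p where "p = q / (av - \<kappa>0) + g / (2 * q)"
  have p: "p > 0" using q av g by (simp add: p_def add_pos_pos)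
  \<comment> \<open>\<open>k1\<close> and \<open>k2\<close> are the decay rates of the summands
    \<open>p * V\<close> and \<open>R\<close>; their minimum is the rate of the sum.\<close>
  define k1 where "k1 = av - q / p"
  define k2 where "k2 = ar - p * q"
  have "p * (av - \<kappa>0) = q + g * (av - \<kappa>0) / (2 * q)"
    using av q by (simp add: p_def field_simps)
  then have "p * (av - \<kappa>0) > q" using g av q by (simp add: divide_pos_pos)
  then have k1: "k1 > \<kappa>0" using p by (simp add: k1_def field_simps)
  have "p * q = q\<^sup>2 / (av - \<kappa>0) + g / 2" using q by (simp add: p_def field_simps power2_eq_square)
  then have "k2 = \<kappa>0 + g / 2" unfolding k2_def g_def by (simp add: field_simps)
  then have k2: "k2 > \<kappa>0" using g by simp
  define \<kappa> where "\<kappa> = min k1 k2"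
  show thesis
  proof (rule that[of p \<kappa>])
    show "p > 0" by (rule p)
    show "\<kappa> > \<kappa>0" using k1 k2 by (simp add: \<kappa>_def)
    fix t assume t: "t \<ge> T"
    define s where "s = real (Suc t)"
    have s: "s > 0" by (simp add: s_def)
    have "p * V (Suc t) + R (Suc t) \<le> p * (V t + (- av * V t + q * R t) / s + C / s\<^sup>2)
        + (R t + (q * V t - ar * R t) / s + C / s\<^sup>2)"
      using V[OF t] R[OF t] p unfolding s_def by (intro add_mono mult_left_mono) auto
    also have "\<dots> = p * V t + R t - (k1 * (p * V t) + k2 * R t) / s + (p + 1) * C / s\<^sup>2"
    proof -
      have "k1 * p = av * p - q" using p by (simp add: k1_def field_simps)
      then have e: "k1 * (p * V t) = (av * p - q) * V t" by (simp add: mult.assoc[symmetric])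
      show ?thesis unfolding e k2_def
        by (simp add: add_divide_distrib diff_divide_distrib algebra_simps)
    qed
    also have "\<dots> \<le> p * V t + R t - \<kappa> * (p * V t + R t) / s + (p + 1) * C / s\<^sup>2"
    proof -
      have "\<kappa> * (p * V t + R t) \<le> k1 * (p * V t) + k2 * R t"
        unfolding distrib_left using V0[OF t] R0[OF t] p
        by (intro add_mono mult_right_mono) (auto simp: \<kappa>_def)
      then show ?thesis using s by (simp add: divide_right_mono)
    qed
    also have "\<dots> = (1 - \<kappa> / s) * (p * V t + R t) + (p + 1) * C / s\<^sup>2"
      by (simp add: algebra_simps add_divide_distrib)
    finally show "p * V (Suc t) + R (Suc t)
       \<le> (1 - \<kappa> / real (Suc t)) * (p * V t + R t) + ((p + 1) * C) / (real (Suc t))\<^sup>2"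
      by (simp add: s_def)
  qed
qed

section \<open>Binary observations with Gaussian noise\<close>

text \<open>Disjoint subfamilies of independent variables generate independent sigma-algebras, and
  this passes to everything measurable with respect to them. Stating it through
  \<open>vimage_algebra\<close> avoids writing \<open>Z\<close> and \<open>W\<close> as explicit
  functions of the noises.\<close>

lemma (in prob_space) indep_var_past:
  fixes X :: "'i \<Rightarrow> 'a \<Rightarrow> real"
  assumes ind: "indep_vars (\<lambda>_. borel) X I" and AB: "A \<inter> B = {}" "A \<subseteq> I" "B \<subseteq> I"
    and Z: "Z \<in> measurable (vimage_algebra (space M) (\<lambda>\<omega>. \<lambda>i\<in>A. X i \<omega>) (PiM A (\<lambda>_. borel))) S"
    and W: "W \<in> measurable (vimage_algebra (space M) (\<lambda>\<omega>. \<lambda>i\<in>B. X i \<omega>) (PiM B (\<lambda>_. borel))) T"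
  shows "indep_var S Z T W"
proof -
  let ?X = "\<lambda>A \<omega>. \<lambda>i\<in>A. X i \<omega>"
  let ?F = "\<lambda>A. vimage_algebra (space M) (?X A) (PiM A (\<lambda>_. borel))"
  have "indep_var (PiM A (\<lambda>_. borel)) (?X A) (PiM B (\<lambda>_. borel)) (?X B)"
    by (rule indep_var_restrict[OF ind AB])
  then have rv: "random_variable (PiM A (\<lambda>_. borel)) (?X A)" "random_variable (PiM B (\<lambda>_. borel)) (?X B)"
    and is1: "indep_set (sets (?F A)) (sets (?F B))"
    unfolding indep_var_eq sets_vimage_algebra by blast+
  have sub: "sets (?F C) \<subseteq> events" if "random_variable (PiM C (\<lambda>_. borel)) (?X C)" for C
    unfolding sets_vimage_algebra using measurable_sets[OF that] by (intro sets.sigma_sets_subset) blast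
  have mM: "random_variable U Y" and sY: "sigma_sets (space M) {Y -` E \<inter> space M | E. E \<in> sets U} \<subseteq> sets (?F C)"
    if C: "random_variable (PiM C (\<lambda>_. borel)) (?X C)" and Y: "Y \<in> measurable (?F C) U"
    for C U and Y :: "'a \<Rightarrow> 'b"
  proof -
    have pre: "Y -` E \<inter> space M \<in> sets (?F C)" if "E \<in> sets U" for E
      using measurable_sets[OF Y that] by simp
    show "random_variable U Y"
      using pre sub[OF C] measurable_space[OF Y] by (intro measurableI) auto
    have "sigma_sets (space (?F C)) {Y -` E \<inter> space M | E. E \<in> sets U} \<subseteq> sets (?F C)"
      using pre by (intro sets.sigma_sets_subset) blast
    then show "sigma_sets (space M) {Y -` E \<inter> space M | E. E \<in> sets U} \<subseteq> sets (?F C)" by simp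
  qed
  have "indep_set (sigma_sets (space M) {Z -` E \<inter> space M | E. E \<in> sets S})
      (sigma_sets (space M) {W -` E \<inter> space M | E. E \<in> sets T})"
    using is1 unfolding indep_set_def
    by (rule indep_sets_mono_sets) (use sY[OF rv(1) Z] sY[OF rv(2) W] in \<open>auto split: bool.split\<close>)
  then show ?thesis unfolding indep_var_eq using mM[OF rv(1) Z] mM[OF rv(2) W] by blast
qed

lemma measurable_past_component:
  fixes X :: "'i \<Rightarrow> 'a \<Rightarrow> real"
  assumes "i \<in> A"
  shows "X i \<in> borel_measurable (vimage_algebra \<Omega> (\<lambda>\<omega>. \<lambda>i\<in>A. X i \<omega>) (PiM A (\<lambda>_. borel)))"
proof -
  have "(\<lambda>\<omega>. \<lambda>i\<in>A. X i \<omega>) \<in> measurable (vimage_algebra \<Omega> (\<lambda>\<omega>. \<lambda>i\<in>A. X i \<omega>) (PiM A (\<lambda>_. borel))) (PiM A (\<lambda>_. borel))"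
    by (rule measurable_vimage_algebra1) (auto simp: space_PiM)
  from measurable_compose[OF this measurable_component_singleton[OF assms]]
  show ?thesis using assms by simp
qed

text \<open>The dummy component of \<open>(D \<omega>, 0)\<close> is there because \<open>indep_var\<close> requires both random
  variables to have the same type.\<close>

lemma (in prob_space) threshold_zero_mean:
  fixes U Y D :: "'a \<Rightarrow> real"
  assumes iv: "indep_var (borel \<Otimes>\<^sub>M borel) (\<lambda>\<omega>. (U \<omega>, Y \<omega>)) (borel \<Otimes>\<^sub>M borel) (\<lambda>\<omega>. (D \<omega>, 0 :: real))"
    and bd: "\<And>\<omega>. \<omega> \<in> space M \<Longrightarrow> \<bar>U \<omega>\<bar> \<le> K" and K: "K \<ge> 0"
  shows "expectation (\<lambda>\<omega>. U \<omega> * ((if Y \<omega> + D \<omega> \<le> c then 1 else 0) - cdf (distr M borel D) (c - Y \<omega>))) = 0"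
proof -
  let ?B = "borel \<Otimes>\<^sub>M borel :: (real \<times> real) measure"
  let ?UY = "\<lambda>\<omega>. (U \<omega>, Y \<omega>)" and ?D0 = "\<lambda>\<omega>. (D \<omega>, 0 :: real)"
  let ?P = "distr M ?B ?UY" and ?Q = "distr M ?B ?D0"
  have rv: "random_variable ?B ?UY" and rvD: "random_variable ?B ?D0"
    and jd: "?P \<Otimes>\<^sub>M ?Q = distr M (?B \<Otimes>\<^sub>M ?B) (\<lambda>\<omega>. (?UY \<omega>, ?D0 \<omega>))"
    using iv unfolding indep_var_distribution_eq by auto
  have Dm [measurable]: "D \<in> borel_measurable M"
    using measurable_fst'[OF rvD] by simp
  interpret P: prob_space ?P by (rule prob_space_distr[OF rv])
  interpret Q: prob_space ?Q by (rule prob_space_distr[OF rvD])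
  interpret QR: real_distribution "distr M borel D" by (rule real_distribution_distr) simp
  interpret PQ: pair_prob_space ?P ?Q ..
  define \<Phi> where "\<Phi> = cdf (distr M borel D)"
  have "mono \<Phi>" unfolding \<Phi>_def mono_def by (auto intro: QR.cdf_nondecreasing)
  then have [measurable]: "\<Phi> \<in> borel_measurable borel" by (rule borel_measurable_mono)
  have Pb: "0 \<le> \<Phi> x" "\<Phi> x \<le> 1" for x
    unfolding \<Phi>_def using QR.cdf_nonneg QR.cdf_bounded_prob by auto
  \<comment> \<open>Clipping the first coordinate with \<open>projM K\<close> makes \<open>g\<close>
    bounded everywhere, hence integrable on the product space; on the actual values of
    \<open>U\<close> the clipping changes nothing.\<close>
  define g :: "(real \<times> real) \<times> (real \<times> real) \<Rightarrow> real" where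
    "g x = projM K (fst (fst x)) *
       ((if snd (fst x) + fst (snd x) \<le> c then 1 else 0) - \<Phi> (c - snd (fst x)))" for x
  have gm: "g \<in> borel_measurable (?B \<Otimes>\<^sub>M ?B)"
    unfolding g_def projM_def by measurable
  have gb: "norm (g x) \<le> K" for x
  proof -
    have "\<bar>projM K (fst (fst x))\<bar> \<le> K" using K by (auto simp: projM_def)
    moreover have "\<bar>(if snd (fst x) + fst (snd x) \<le> c then 1 else 0) - \<Phi> (c - snd (fst x))\<bar> \<le> 1"
      using Pb[of "c - snd (fst x)"] by auto
    ultimately show ?thesis
      using mult_mono[of "\<bar>projM K (fst (fst x))\<bar>" K
          "\<bar>(if snd (fst x) + fst (snd x) \<le> c then 1 else 0) - \<Phi> (c - snd (fst x))\<bar>" 1] K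
      by (simp add: g_def abs_mult)
  qed
  have gm': "g \<in> borel_measurable (?P \<Otimes>\<^sub>M ?Q)"
    using gm by (simp cong: measurable_cong_sets)
  have gi: "integrable (?P \<Otimes>\<^sub>M ?Q) g"
    by (rule PQ.integrable_const_bound[of _ K]) (use gm' gb in auto)
  \<comment> \<open>For frozen values of (U, Y) the bit has mean equal to the distribution function
    of D at c - Y, so the inner Fubini integral vanishes pointwise.\<close>
  have inner: "(\<integral>z. g (x, z) \<partial>?Q) = 0" for x
  proof -
    have "(\<integral>\<omega>. (if snd x + D \<omega> \<le> c then 1 else 0 :: real) \<partial>M) = (\<integral>\<omega>. indicator {..c - snd x} (D \<omega>) \<partial>M)"
      by (intro Bochner_Integration.integral_cong) (auto simp: indicator_def)
    also have "\<dots> = (\<integral>z. indicator {..c - snd x} z \<partial>distr M borel D)"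
      by (rule integral_distr[symmetric]) auto
    also have "\<dots> = \<Phi> (c - snd x)" by (simp add: \<Phi>_def cdf_def)
    finally have e: "(\<integral>\<omega>. (if snd x + D \<omega> \<le> c then 1 else 0 :: real) \<partial>M) = \<Phi> (c - snd x)" .
    have i1: "integrable M (\<lambda>\<omega>. if snd x + D \<omega> \<le> c then 1 else 0 :: real)"
      by (rule integrable_const_bound[of _ 1]) auto
    have "(\<integral>z. g (x, z) \<partial>?Q) = (\<integral>\<omega>. g (x, ?D0 \<omega>) \<partial>M)"
      by (rule integral_distr[OF rvD]) (rule measurable_compose[OF measurable_Pair1' gm], simp add: space_pair_measure)
    also have "\<dots> = projM K (fst x) * (\<integral>\<omega>. (if snd x + D \<omega> \<le> c then 1 else 0) - \<Phi> (c - snd x) \<partial>M)"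
      by (simp add: g_def)
    also have "(\<integral>\<omega>. (if snd x + D \<omega> \<le> c then 1 else 0) - \<Phi> (c - snd x) \<partial>M) = 0"
      using e i1 by (subst Bochner_Integration.integral_diff) (auto simp: prob_space)
    finally show ?thesis by simp
  qed
  have "expectation (\<lambda>\<omega>. U \<omega> * ((if Y \<omega> + D \<omega> \<le> c then 1 else 0) - \<Phi> (c - Y \<omega>)))
      = expectation (\<lambda>\<omega>. g (?UY \<omega>, ?D0 \<omega>))"
  proof (intro Bochner_Integration.integral_cong refl)
    fix \<omega> assume "\<omega> \<in> space M"
    then have "projM K (U \<omega>) = U \<omega>" using bd[of \<omega>] by (auto simp: projM_def)
    then show "U \<omega> * ((if Y \<omega> + D \<omega> \<le> c then 1 else 0) - \<Phi> (c - Y \<omega>)) = g (?UY \<omega>, ?D0 \<omega>)"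
      by (simp add: g_def)
  qed
  also have "\<dots> = (\<integral>x. g x \<partial>(?P \<Otimes>\<^sub>M ?Q))"
    unfolding jd by (rule integral_distr[symmetric]) (use rv rvD gm in auto)
  also have "\<dots> = (\<integral>x. (\<integral>z. g (x, z) \<partial>?Q) \<partial>?P)"
    by (rule PQ.integral_fst'[symmetric]) (rule gi)
  finally show ?thesis by (simp add: inner \<Phi>_def)
qed

section \<open>Slope of the Gaussian distribution function\<close>

lemma normal_density_antimono_abs:
  assumes "\<sigma> > 0" "\<bar>x\<bar> \<le> y"
  shows "normal_density 0 \<sigma> y \<le> normal_density 0 \<sigma> x"
proof -
  have "x\<^sup>2 \<le> y\<^sup>2" using assms(2) by (simp add: abs_le_square_iff[symmetric])
  then show ?thesis
    using assms(1) unfolding normal_density_def by (intro mult_left_mono) (auto intro!: divide_right_mono)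
qed

text \<open>The increment is the integral of the density over (a, b], where all arguments have
  modulus at most \<open>A\<close> and the density is therefore at least its value at
  \<open>A\<close>.\<close>

lemma gauss_cdf_diff_ge:
  assumes s: "\<sigma> > 0" and ab: "a \<le> b" "\<bar>a\<bar> \<le> A" "\<bar>b\<bar> \<le> A"
  shows "gauss_cdf \<sigma> b - gauss_cdf \<sigma> a \<ge> gauss_pdf \<sigma> A * (b - a)"
proof (cases "a = b")
  case False
  let ?N = "density lborel (\<lambda>y. ennreal (normal_density 0 \<sigma> y))"
  interpret prob_space ?N by (rule prob_space_normal_density[OF s])
  interpret real_distribution ?N by unfold_locales auto
  have "ennreal (gauss_pdf \<sigma> A * (b - a)) = (\<integral>\<^sup>+x. ennreal (gauss_pdf \<sigma> A) * indicator {a<..b} x \<partial>lborel)"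
    using ab s by (simp add: nn_integral_cmult_indicator gauss_pdf_def ennreal_mult)
  also have "\<dots> \<le> (\<integral>\<^sup>+x. ennreal (normal_density 0 \<sigma> x) * indicator {a<..b} x \<partial>lborel)"
    using ab s unfolding gauss_pdf_def
    by (intro nn_integral_mono) (auto simp: indicator_def intro!: ennreal_leI normal_density_antimono_abs)
  also have "\<dots> = emeasure ?N {a<..b}"
    by (subst emeasure_density) auto
  also have "\<dots> = ennreal (measure ?N {a<..b})" by (rule emeasure_eq_measure)
  finally have "gauss_pdf \<sigma> A * (b - a) \<le> measure ?N {a<..b}"
    by (subst (asm) ennreal_le_iff) auto
  also have "\<dots> = cdf ?N b - cdf ?N a"
    using ab False by (intro cdf_diff_eq[symmetric]) simp
  finally show ?thesis by (simp add: gauss_cdf_def)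
qed simp

text \<open>This produces the constant \<open>fM_const\<close>: for u and y in [-K, K] both c - u
  and c - y have modulus at most |c| + K. The roles of u and y are symmetric, so one ordering
  suffices.\<close>

lemma gauss_cdf_strongly_monotone:
  assumes s: "\<sigma> > 0" and "\<bar>u\<bar> \<le> K" "\<bar>y\<bar> \<le> K"
  shows "(u - y) * (gauss_cdf \<sigma> (c - u) - gauss_cdf \<sigma> (c - y)) \<le> - gauss_pdf \<sigma> (\<bar>c\<bar> + K) * (u - y)\<^sup>2"
proof -
  have *: "(u - y) * (gauss_cdf \<sigma> (c - u) - gauss_cdf \<sigma> (c - y)) \<le> - gauss_pdf \<sigma> (\<bar>c\<bar> + K) * (u - y)\<^sup>2"
    if "y \<le> u" "\<bar>u\<bar> \<le> K" "\<bar>y\<bar> \<le> K" for u y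
  proof -
    have "gauss_pdf \<sigma> (\<bar>c\<bar> + K) * (u - y) \<le> gauss_cdf \<sigma> (c - y) - gauss_cdf \<sigma> (c - u)"
      using gauss_cdf_diff_ge[OF s, of "c - u" "c - y" "\<bar>c\<bar> + K"] that by auto
    from mult_left_mono[OF this, of "u - y"] that(1) show ?thesis
      by (simp add: power2_eq_square algebra_simps)
  qed
  show ?thesis
  proof (cases "y \<le> u")
    case False
    then show ?thesis using *[of u y] assms by (simp add: power2_commute algebra_simps)
  qed (use * assms in auto)
qed

lemma gauss_cdf_bounds:
  assumes "\<sigma> > 0"
  shows "0 \<le> gauss_cdf \<sigma> x" "gauss_cdf \<sigma> x \<le> 1"
proof -
  let ?N = "density lborel (\<lambda>y. ennreal (normal_density 0 \<sigma> y))"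
  interpret prob_space ?N by (rule prob_space_normal_density[OF assms])
  interpret real_distribution ?N by unfold_locales auto
  show "0 \<le> gauss_cdf \<sigma> x" "gauss_cdf \<sigma> x \<le> 1"
    unfolding gauss_cdf_def using cdf_nonneg cdf_bounded_prob by auto
qed

lemma gauss_cdf_measurable:
  assumes "\<sigma> > 0"
  shows "gauss_cdf \<sigma> \<in> borel_measurable borel"
proof -
  let ?N = "density lborel (\<lambda>y. ennreal (normal_density 0 \<sigma> y))"
  interpret prob_space ?N by (rule prob_space_normal_density[OF assms])
  interpret real_distribution ?N by unfold_locales auto
  have "mono (gauss_cdf \<sigma>)"
    unfolding gauss_cdf_def mono_def by (auto intro: cdf_nondecreasing)
  then show ?thesis by (rule borel_measurable_mono)
qed

section \<open>One step of the consensus dynamics\<close>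

text \<open>Both bounds expand a square of the form |old + h * change|^2 and estimate the cross
  term. With w = W e - L \<delta>, the term 2 <\<delta>, w> is controlled by lambda2 and J W, and
  the term - 2 <e, Q w> by Q W and Q L.\<close>

lemma consensus_step_bounds:
  fixes y y' w \<delta> \<delta>' :: "nat \<Rightarrow> real" and z e :: "nat \<times> nat \<Rightarrow> real"
  assumes G: "undirected_graph N Nb" and conn: "graph_connected N Nb" and N: "N \<ge> 2" and h: "h \<ge> 0"
  defines "\<delta> \<equiv> \<lambda>i. y i - (\<Sum>l\<in>{1..N}. y l) / real N"
    and "e \<equiv> \<lambda>p. z p - y (snd p)"
    and "w \<equiv> \<lambda>i. \<Sum>j\<in>Nb i. z (i, j) - y i"
    and "y' \<equiv> \<lambda>i. y i + h * w i"
    and "\<delta>' \<equiv> \<lambda>i. y' i - (\<Sum>l\<in>{1..N}. y' l) / real N"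
  shows disagreement_step: "(\<Sum>i\<in>{1..N}. (\<delta>' i)\<^sup>2) \<le> (\<Sum>i\<in>{1..N}. (\<delta> i)\<^sup>2)
      + h * (- lambda2 N Nb * (\<Sum>i\<in>{1..N}. (\<delta> i)\<^sup>2) + lambdaG N Nb / lambda2 N Nb * (\<Sum>p\<in>pairs N Nb. (e p)\<^sup>2))
      + h\<^sup>2 * (\<Sum>i\<in>{1..N}. (w i)\<^sup>2)" (is ?A)
    and estimate_step: "(\<Sum>p\<in>pairs N Nb. (z p - y' (snd p))\<^sup>2) \<le> (\<Sum>p\<in>pairs N Nb. (e p)\<^sup>2)
      + h * (alpha_const N Nb * (\<Sum>p\<in>pairs N Nb. (e p)\<^sup>2) + lambdaG N Nb / lambda2 N Nb * (\<Sum>i\<in>{1..N}. (\<delta> i)\<^sup>2))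
      + h\<^sup>2 * (\<Sum>p\<in>pairs N Nb. (w (snd p))\<^sup>2)" (is ?B)
proof -
  let ?P = "pairs N Nb" and ?I = "{1..N}"
  let ?D = "\<Sum>i\<in>?I. (\<delta> i)\<^sup>2" and ?E = "\<Sum>p\<in>?P. (e p)\<^sup>2"
  define l2 where "l2 = lambda2 N Nb"
  define lG where "lG = lambdaG N Nb"
  have l2: "l2 > 0" unfolding l2_def by (rule lambda2_pos[OF G conn N])
  have lG: "lG > 0" unfolding lG_def by (rule lambdaG_pos[OF G conn N])
  note fin = finite_pairs[OF G] and ne = pairs_nonempty[OF G conn N]
  have \<delta>0: "(\<Sum>i\<in>?I. \<delta> i) = 0" using N by (simp add: \<delta>_def sum_subtractf)
  have Lin: "(\<Sum>j\<in>Nb i. y i - y j) = (\<Sum>j\<in>Nb i. \<delta> i - \<delta> j)" for i by (simp add: \<delta>_def)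
  have w_eq: "w i = (\<Sum>j\<in>Nb i. e (i, j)) - (\<Sum>j\<in>Nb i. \<delta> i - \<delta> j)" for i
    unfolding w_def Lin[symmetric] sum_subtractf[symmetric] by (simp add: e_def)
  have w_mat: "w i = (\<Sum>p\<in>?P. Wmat i p * e p) - (\<Sum>k\<in>?I. laplacian Nb i k * \<delta> k)" if "i \<in> ?I" for i
    unfolding w_eq Wmat_apply[OF G that] laplacian_apply[OF G that] ..

  define wm where "wm = (\<Sum>i\<in>?I. w i) / real N"
  have wsum: "(\<Sum>i\<in>?I. w i) = real N * wm" using N by (simp add: wm_def)
  have \<delta>': "\<delta>' i = \<delta> i + h * (w i - wm)" for i
    by (simp add: \<delta>'_def \<delta>_def y'_def wm_def sum.distrib sum_distrib_left[symmetric] add_divide_distrib algebra_simps)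
  have "(\<Sum>i\<in>?I. (\<delta>' i)\<^sup>2) = ?D + h * (2 * (\<Sum>i\<in>?I. \<delta> i * (w i - wm))) + h\<^sup>2 * (\<Sum>i\<in>?I. (w i - wm)\<^sup>2)"
    unfolding sum_distrib_left sum.distrib[symmetric]
    by (intro sum.cong refl) (simp add: \<delta>' power2_eq_square algebra_simps)
  also have "(\<Sum>i\<in>?I. \<delta> i * (w i - wm)) = (\<Sum>i\<in>?I. \<delta> i * w i)"
    using \<delta>0 by (simp add: right_diff_distrib sum_subtractf sum_distrib_right[symmetric])
  \<comment> \<open>The variance identity: centring \<open>w\<close> can only decrease its square
    norm.\<close>
  also have "(\<Sum>i\<in>?I. (w i - wm)\<^sup>2) = (\<Sum>i\<in>?I. (w i)\<^sup>2) - real N * wm\<^sup>2"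
  proof -
    have "(\<Sum>i\<in>?I. (w i - wm)\<^sup>2) = (\<Sum>i\<in>?I. (w i)\<^sup>2) - 2 * wm * (\<Sum>i\<in>?I. w i) + (\<Sum>i\<in>?I. wm\<^sup>2)"
      unfolding sum_distrib_left sum_subtractf[symmetric] sum.distrib[symmetric]
      by (intro sum.cong refl) (simp add: power2_eq_square algebra_simps)
    then show ?thesis unfolding wsum by (simp add: power2_eq_square)
  qed
  finally have e1: "(\<Sum>i\<in>?I. (\<delta>' i)\<^sup>2)
      \<le> ?D + h * (2 * (\<Sum>i\<in>?I. \<delta> i * w i)) + h\<^sup>2 * (\<Sum>i\<in>?I. (w i)\<^sup>2)"
    by (simp add: mult_left_mono)
  have "2 * (\<Sum>i\<in>?I. \<delta> i * w i) \<le> - l2 * ?D + lG / l2 * ?E"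
  proof -
    have "(\<Sum>i\<in>?I. \<delta> i * w i)
        = (\<Sum>i\<in>?I. \<delta> i * (\<Sum>j\<in>Nb i. e (i, j))) - (\<Sum>i\<in>?I. \<delta> i * (\<Sum>j\<in>Nb i. \<delta> i - \<delta> j))"
      unfolding w_eq by (simp add: right_diff_distrib sum_subtractf)
    moreover have "l2 * ?D \<le> (\<Sum>i\<in>?I. \<delta> i * (\<Sum>j\<in>Nb i. \<delta> i - \<delta> j))"
      unfolding l2_def by (rule lambda2_form_le[OF G conn N \<delta>0])
    moreover have "2 * (\<Sum>i\<in>?I. \<delta> i * (\<Sum>j\<in>Nb i. e (i, j))) \<le> l2 * ?D + lG / l2 * ?E"
    proof -
      \<comment> \<open>Since \<open>\<delta>\<close> has sum zero, W may be replaced by J W in the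
        cross term; this is why \<open>lambdaG\<close> is built from J W.\<close>
      define We where "We i = (\<Sum>j\<in>Nb i. e (i, j))" for i
      have "(\<Sum>p\<in>?P. matprod ?I (Jmat N) Wmat i p * e p) = We i - (\<Sum>s\<in>?I. We s) / real N" if "i \<in> ?I" for i
        unfolding matprod_apply[OF finite_atLeastAtMost fin] Jmat_apply[OF that, symmetric]
        by (intro sum.cong refl) (simp only: Wmat_apply[OF G] We_def)
      then have "(\<Sum>i\<in>?I. \<delta> i * (\<Sum>p\<in>?P. matprod ?I (Jmat N) Wmat i p * e p))
          = (\<Sum>i\<in>?I. \<delta> i * (We i - (\<Sum>s\<in>?I. We s) / real N))"
        by (intro sum.cong refl) simp
      also have "\<dots> = (\<Sum>i\<in>?I. \<delta> i * We i)"
        using \<delta>0 by (simp add: right_diff_distrib sum_subtractf sum_distrib_right[symmetric] sum_divide_distrib[symmetric])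
      finally have eq: "(\<Sum>i\<in>?I. \<delta> i * (\<Sum>p\<in>?P. matprod ?I (Jmat N) Wmat i p * e p)) = (\<Sum>i\<in>?I. \<delta> i * We i)" .
      \<comment> \<open>The weight \<open>l2 / lG\<close> is chosen so that Young's inequality
        spends exactly half of the dissipation \<open>2 * l2 * ?D\<close>.\<close>
      have "2 * (\<Sum>i\<in>?I. \<delta> i * We i) \<le> l2 / lG * lG * ?D + ?E / (l2 / lG)"
        unfolding eq[symmetric] lG_def lambdaG_def
        by (rule spec_norm_young) (use fin ne l2 lG in \<open>auto simp: lG_def lambdaG_def\<close>)
      then show ?thesis using l2 lG by (simp add: We_def mult.commute)
    qed
    ultimately show ?thesis by (simp add: algebra_simps)
  qed
  from mult_left_mono[OF this h] e1 show ?A unfolding l2_def lG_def by linarith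

  define q where "q = spec_norm ?P ?P (matprod ?I Qmat Wmat)"
  have q: "q \<ge> 0" "sqrt (lambdaQW N Nb) = q"
    unfolding q_def lambdaQW_def using spec_norm_nonneg[OF fin fin ne] by auto
  have "(\<Sum>p\<in>?P. (z p - y' (snd p))\<^sup>2)
      = ?E + h * (- 2 * (\<Sum>p\<in>?P. e p * w (snd p))) + h\<^sup>2 * (\<Sum>p\<in>?P. (w (snd p))\<^sup>2)"
    unfolding sum_distrib_left sum.distrib[symmetric]
    by (intro sum.cong refl) (simp add: e_def y'_def power2_eq_square algebra_simps)
  note e2 = this
  have "- 2 * (\<Sum>p\<in>?P. e p * w (snd p)) \<le> alpha_const N Nb * ?E + lG / l2 * ?D"
  proof -
    have QW: "(\<Sum>p'\<in>?P. matprod ?I Qmat Wmat p p' * e p') = (\<Sum>p'\<in>?P. Wmat (snd p) p' * e p')" if "p \<in> ?P" for p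
      unfolding matprod_apply[OF finite_atLeastAtMost fin] by (rule Qmat_apply[OF G that])
    have QL: "(\<Sum>k\<in>?I. matprod ?I Qmat (laplacian Nb) p k * \<delta> k) = (\<Sum>k\<in>?I. laplacian Nb (snd p) k * \<delta> k)" if "p \<in> ?P" for p
      unfolding matprod_apply[OF finite_atLeastAtMost finite_atLeastAtMost] by (rule Qmat_apply[OF G that])
    have "(\<Sum>p\<in>?P. e p * w (snd p)) = (\<Sum>p\<in>?P. e p * (\<Sum>p'\<in>?P. matprod ?I Qmat Wmat p p' * e p'))
        - (\<Sum>p\<in>?P. e p * (\<Sum>k\<in>?I. matprod ?I Qmat (laplacian Nb) p k * \<delta> k))"
      unfolding sum_subtractf[symmetric]
      by (intro sum.cong refl) (simp only: QW QL w_mat[OF pairs_in(2)[OF G]] right_diff_distrib)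
    moreover have "\<bar>\<Sum>p\<in>?P. e p * (\<Sum>p'\<in>?P. matprod ?I Qmat Wmat p p' * e p')\<bar> \<le> q * ?E"
      using spec_norm_bilinear[OF fin fin ne, of e "matprod ?I Qmat Wmat" e]
      by (simp add: q_def sum_nonneg)
    \<comment> \<open>The same weight again: it yields the second summand of
      \<open>alpha_const\<close> and makes the two coupling coefficients both equal to lambdaG /
      lambda2.\<close>
    moreover have "2 * (\<Sum>p\<in>?P. e p * (\<Sum>k\<in>?I. matprod ?I Qmat (laplacian Nb) p k * \<delta> k))
        \<le> l2 / lG * lambdaQL N Nb * ?E + ?D / (l2 / lG)"
      unfolding lambdaQL_def
      by (rule spec_norm_young) (use fin N l2 lG in auto)
    ultimately have "- 2 * (\<Sum>p\<in>?P. e p * w (snd p)) \<le> 2 * (q * ?E) + (l2 / lG * lambdaQL N Nb * ?E + ?D / (l2 / lG))"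
      by linarith
    also have "\<dots> = alpha_const N Nb * ?E + lG / l2 * ?D"
      unfolding alpha_const_def q(2) l2_def[symmetric] lG_def[symmetric]
      by (simp add: algebra_simps)
    finally show ?thesis .
  qed
  from mult_left_mono[OF this h] e2 show ?B unfolding l2_def lG_def by linarith
qed

section \<open>The projection and the closed loop under K2\<close>

lemma projM_nonexpansive:
  assumes "\<bar>y\<bar> \<le> K"
  shows "(projM K a - y)\<^sup>2 \<le> (a - y)\<^sup>2"
proof -
  have "\<bar>projM K a - y\<bar> \<le> \<bar>a - y\<bar>" using assms by (auto simp: projM_def)
  then show ?thesis by (simp add: abs_le_square_iff)
qed

lemma projM_bound: "K \<ge> 0 \<Longrightarrow> \<bar>projM K a\<bar> \<le> K"
  by (auto simp: projM_def)

text \<open>K2 A x is the shifted sum of b_k x_{k+1} plus the last row of A. The gain K1 cancels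
  that last row and trades each b_{k-1} for b_k, which restores K2 x; \<open>v\<close> enters with
  the last entry 1 of K2.\<close>

lemma rowmul_K2_closed_loop:
  assumes "n \<ge> 2"
  shows "rowmul n (K2coef n b) (\<lambda>k. Amul n a x k + Bmul n (rowmul n (K1coef n a b) x + v) k)
       = rowmul n (K2coef n b) x + v"
proof -
  obtain m where n: "n = Suc m" and m: "m \<ge> 1" using assms by (cases n) auto
  have split: "(\<Sum>k\<in>{1..n}. g k) = (\<Sum>k\<in>{1..m}. g k) + g n" for g :: "nat \<Rightarrow> real"
    using n by simp
  have shift: "(\<Sum>k\<in>{1..m}. b k * x (Suc k)) = (\<Sum>k\<in>{1..m}. (if k = 1 then 0 else b (k - 1) * x k)) + b m * x n"
    using m unfolding n
  proof (induction m)
    case (Suc m)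
    then show ?case by (cases "m = 0") auto
  qed simp
  have K1: "rowmul n (K1coef n a b) x
      = (\<Sum>k\<in>{1..m}. - a k * x k + b k * x k - (if k = 1 then 0 else b (k - 1) * x k)) + (- a n - b m + 1) * x n"
    unfolding rowmul_def split using n m
    by (simp add: K1coef_def) (intro sum.cong refl, auto simp: algebra_simps)
  have "rowmul n (K2coef n b) (\<lambda>k. Amul n a x k + Bmul n (rowmul n (K1coef n a b) x + v) k)
      = (\<Sum>k\<in>{1..m}. b k * x (Suc k)) + (\<Sum>l\<in>{1..n}. a l * x l) + rowmul n (K1coef n a b) x + v"
    unfolding rowmul_def[of n "K2coef n b"] split
    using n by (simp add: K2coef_def Amul_def Bmul_def)
  also have "\<dots> = (\<Sum>k\<in>{1..m}. b k * x k) + x n + v"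
    unfolding shift K1 split[of "\<lambda>l. a l * x l"]
    by (simp add: sum.distrib sum_subtractf sum_negf algebra_simps)
  also have "(\<Sum>k\<in>{1..m}. b k * x k) + x n = rowmul n (K2coef n b) x"
    unfolding rowmul_def split using n by (simp add: K2coef_def)
  finally show ?thesis .
qed

lemma rowmul_mean:
  "rowmul n K (\<lambda>k. (\<Sum>l\<in>A. x l k) / r) = (\<Sum>l\<in>A. rowmul n K (x l)) / r"
  unfolding rowmul_def sum_distrib_left sum_divide_distrib
  by (subst sum.swap) (simp add: sum_distrib_left sum_divide_distrib)

section \<open>Mean square analysis\<close>

text \<open>The scalar system left after compression: \<open>y i\<close> stands for K2 x_i, and
  neither the state vectors nor A and B occur any more. The recursions are restated with
  \<open>Suc t\<close>, the form used in inductions.\<close>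

locale binary_consensus = prob_space Pr for Pr :: "'w measure" +
  fixes N :: nat and Nb :: "nat \<Rightarrow> nat set" and c :: "nat \<Rightarrow> nat \<Rightarrow> real"
    and \<sigma> \<beta> \<gamma> Mb :: real and t0 :: nat
    and d :: "nat \<Rightarrow> nat \<Rightarrow> nat \<Rightarrow> 'w \<Rightarrow> real"
    and y0 :: "nat \<Rightarrow> real" and z0 :: "nat \<Rightarrow> nat \<Rightarrow> real"
    and y :: "nat \<Rightarrow> nat \<Rightarrow> 'w \<Rightarrow> real"
    and zh :: "nat \<Rightarrow> nat \<Rightarrow> nat \<Rightarrow> 'w \<Rightarrow> real"
  assumes N2: "N \<ge> 2" and graph: "undirected_graph N Nb" and conn: "graph_connected N Nb"
    and sigma_pos: "\<sigma> > 0" and beta_pos: "\<beta> > 0" and gamma_pos: "\<gamma> > 0"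
    and t0_bound: "real t0 > \<gamma> * real (dmax N Nb) - 1"
    and M_pos: "Mb > 0"
    and y0_bound: "\<And>i. i \<in> {1..N} \<Longrightarrow> \<bar>y0 i\<bar> \<le> Mb"
    and z0_bound: "\<And>i j. (i, j) \<in> pairs N Nb \<Longrightarrow> \<bar>z0 i j\<bar> \<le> Mb"
    and noise_indep: "indep_vars (\<lambda>_. borel) (\<lambda>(i, j, t). d i j t) {(i, j, t). (i, j) \<in> pairs N Nb}"
    and noise_gauss: "\<And>i j t. (i, j) \<in> pairs N Nb \<Longrightarrow>
          distributed Pr lborel (d i j t) (\<lambda>y. ennreal (normal_density 0 \<sigma> y))"
    and y_init: "\<And>\<omega> i. \<omega> \<in> space Pr \<Longrightarrow> i \<in> {1..N} \<Longrightarrow> y i (Suc t0) \<omega> = y0 i"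
    and z_init: "\<And>\<omega> i j. \<omega> \<in> space Pr \<Longrightarrow> (i, j) \<in> pairs N Nb \<Longrightarrow> zh i j t0 \<omega> = z0 i j"
    and z_step: "\<And>\<omega> t i j. \<omega> \<in> space Pr \<Longrightarrow> t \<ge> t0 \<Longrightarrow> (i, j) \<in> pairs N Nb \<Longrightarrow>
        zh i j (Suc t) \<omega> = projM Mb (zh i j t \<omega> + \<beta> / real (Suc t) *
          (gauss_cdf \<sigma> (c i j - zh i j t \<omega>)
           - (if y j (Suc t) \<omega> + d i j (Suc t) \<omega> \<le> c i j then 1 else 0)))"
    and y_step: "\<And>\<omega> t i. \<omega> \<in> space Pr \<Longrightarrow> t \<ge> Suc t0 \<Longrightarrow> i \<in> {1..N} \<Longrightarrow>
        y i (Suc t) \<omega> = y i t \<omega> + \<gamma> / real (Suc t) * (\<Sum>j \<in> Nb i. zh i j t \<omega> - y i t \<omega>)"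
begin

section \<open>Pathwise bounds\<close>

lemma pair_mem: "i \<in> {1..N} \<Longrightarrow> j \<in> Nb i \<Longrightarrow> (i, j) \<in> pairs N Nb"
  by (auto simp: pairs_def)

lemma zh_bound:
  assumes "\<omega> \<in> space Pr" "t \<ge> t0" "(i, j) \<in> pairs N Nb"
  shows "\<bar>zh i j t \<omega>\<bar> \<le> Mb"
proof (cases "t = t0")
  case True
  then show ?thesis using assms z_init z0_bound by simp
next
  case False
  then obtain s where "t = Suc s" "s \<ge> t0" using assms(2) by (cases t) auto
  then show ?thesis using z_step[OF assms(1) _ assms(3), of s] projM_bound[of Mb] M_pos by simp
qed

lemma degree_bound:
  assumes "i \<in> {1..N}" "t \<ge> t0"
  shows "\<gamma> / real (Suc t) * real (card (Nb i)) \<le> 1"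
proof -
  have "card (Nb i) \<le> dmax N Nb" unfolding dmax_def using assms by (intro Max_ge) auto
  then have "\<gamma> * real (card (Nb i)) \<le> \<gamma> * real (dmax N Nb)" using gamma_pos by simp
  also have "\<dots> \<le> real (Suc t)" using t0_bound assms(2) by simp
  finally show ?thesis by (simp add: field_simps)
qed

lemma card_Nb_le: "i \<in> {1..N} \<Longrightarrow> card (Nb i) \<le> N"
  using graph card_mono[of "{1..N}" "Nb i"] unfolding undirected_graph_def by fastforce

text \<open>The step size condition makes the new value a convex combination of old values
  and estimates.\<close>

lemma y_bound:
  assumes "\<omega> \<in> space Pr" "t \<ge> Suc t0" "i \<in> {1..N}"
  shows "\<bar>y i t \<omega>\<bar> \<le> Mb"
  using assms(2)
proof (induction t rule: dec_induct)
  case base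
  then show ?case using y_init[OF assms(1,3)] y0_bound[OF assms(3)] by simp
next
  case (step t)
  define h where "h = \<gamma> / real (Suc t)"
  define k where "k = real (card (Nb i))"
  have h: "h \<ge> 0" using gamma_pos by (simp add: h_def)
  have hk: "h * k \<le> 1" using degree_bound[OF assms(3), of t] step by (simp add: h_def k_def)
  have "y i (Suc t) \<omega> = (1 - h * k) * y i t \<omega> + h * (\<Sum>j \<in> Nb i. zh i j t \<omega>)"
    using y_step[OF assms(1) _ assms(3), of t] step
    by (simp add: h_def k_def sum_subtractf algebra_simps)
  moreover have "\<bar>(1 - h * k) * y i t \<omega>\<bar> \<le> (1 - h * k) * Mb"
    using hk step.IH by (simp add: abs_mult mult_left_mono)
  moreover have "\<bar>\<Sum>j \<in> Nb i. zh i j t \<omega>\<bar> \<le> k * Mb"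
  proof -
    have "\<bar>\<Sum>j \<in> Nb i. zh i j t \<omega>\<bar> \<le> (\<Sum>j \<in> Nb i. \<bar>zh i j t \<omega>\<bar>)" by (rule sum_abs)
    also have "\<dots> \<le> (\<Sum>j \<in> Nb i. Mb)"
      using step assms by (intro sum_mono zh_bound pair_mem) auto
    finally show ?thesis by (simp add: k_def)
  qed
  then have "\<bar>h * (\<Sum>j \<in> Nb i. zh i j t \<omega>)\<bar> \<le> h * (k * Mb)"
    using h by (simp add: abs_mult mult_left_mono)
  ultimately show ?case by (simp add: algebra_simps) 
qed

section \<open>The noise filtration and the zero-mean innovation\<close>

definition noise :: "nat \<times> nat \<times> nat \<Rightarrow> 'w \<Rightarrow> real" where
  "noise = (\<lambda>(i, j, t). d i j t)"

definition past_idx :: "nat \<Rightarrow> (nat \<times> nat \<times> nat) set" where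
  "past_idx t = {(i, j, s). (i, j) \<in> pairs N Nb \<and> s \<le> t}"

text \<open>The natural filtration of the noises.\<close>

definition past :: "nat \<Rightarrow> 'w measure" where
  "past t = vimage_algebra (space Pr) (\<lambda>\<omega>. \<lambda>k\<in>past_idx t. noise k \<omega>) (PiM (past_idx t) (\<lambda>_. borel))"

lemma space_past [simp]: "space (past t) = space Pr"
  by (simp add: past_def)

lemma noise_past:
  assumes "(i, j) \<in> pairs N Nb" "s \<le> t"
  shows "d i j s \<in> borel_measurable (past t)"
  using measurable_past_component[of "(i, j, s)" "past_idx t" noise] assms
  unfolding past_def by (simp add: past_idx_def noise_def)

lemma noise_rv: "k \<in> {(i, j, t). (i, j) \<in> pairs N Nb} \<Longrightarrow> noise k \<in> borel_measurable Pr"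
  using noise_indep unfolding indep_vars_def noise_def by blast

lemma past_le: "f \<in> borel_measurable (past t) \<Longrightarrow> f \<in> borel_measurable Pr"
proof -
  have "(\<lambda>\<omega>. \<lambda>k\<in>past_idx t. noise k \<omega>) \<in> measurable Pr (PiM (past_idx t) (\<lambda>_. borel))"
    by (intro measurable_restrict noise_rv) (auto simp: past_idx_def)
  then have "(\<lambda>\<omega>. \<omega>) \<in> measurable Pr (past t)"
    unfolding past_def by (intro measurable_vimage_algebra2) auto
  then show "f \<in> borel_measurable Pr" if "f \<in> borel_measurable (past t)"
    using measurable_compose that by blast
qed

text \<open>The indices are offset because \<open>y i (Suc t)\<close> is computed from the estimates
  of time \<open>t\<close>, so both are functions of the noises up to \<open>t\<close>. Fixing
  \<open>T\<close> beyond \<open>t\<close> keeps the induction inside a single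
  sigma-algebra.\<close>

lemma adapted:
  assumes "t0 \<le> t" "t \<le> T"
  shows "(\<forall>i j. (i, j) \<in> pairs N Nb \<longrightarrow> zh i j t \<in> borel_measurable (past T)) \<and>
         (\<forall>i\<in>{1..N}. y i (Suc t) \<in> borel_measurable (past T))"
  using assms
proof (induction t rule: dec_induct)
  case base
  have "zh i j t0 \<in> borel_measurable (past T)" if "(i, j) \<in> pairs N Nb" for i j
    by (subst measurable_cong[where g = "\<lambda>_. z0 i j"]) (use z_init that in auto)
  moreover have "y i (Suc t0) \<in> borel_measurable (past T)" if "i \<in> {1..N}" for i
    by (subst measurable_cong[where g = "\<lambda>_. y0 i"]) (use y_init that in auto)
  ultimately show ?case by blast
next
  case (step t)
  note [measurable] = gauss_cdf_measurable[OF sigma_pos]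
  have z: "zh i j (Suc t) \<in> borel_measurable (past T)" if ij: "(i, j) \<in> pairs N Nb" for i j
  proof -
    have [measurable]: "zh i j t \<in> borel_measurable (past T)" "y j (Suc t) \<in> borel_measurable (past T)"
      "d i j (Suc t) \<in> borel_measurable (past T)"
      using step ij pairs_in(2)[OF graph ij] noise_past[OF ij] by auto
    show ?thesis
      by (subst measurable_cong[where g = "\<lambda>\<omega>. projM Mb (zh i j t \<omega> + \<beta> / real (Suc t) *
          (gauss_cdf \<sigma> (c i j - zh i j t \<omega>)
           - (if y j (Suc t) \<omega> + d i j (Suc t) \<omega> \<le> c i j then 1 else 0)))"])
        (use z_step ij step in \<open>auto simp: projM_def\<close>)
  qed
  moreover have "y i (Suc (Suc t)) \<in> borel_measurable (past T)" if i: "i \<in> {1..N}" for i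
  proof -
    have [measurable]: "y i (Suc t) \<in> borel_measurable (past T)" using step i by simp
    have "(\<lambda>\<omega>. zh i j (Suc t) \<omega>) \<in> borel_measurable (past T)" if "j \<in> Nb i" for j
      using z[OF pair_mem[OF i that]] .
    then have "(\<lambda>\<omega>. \<Sum>j \<in> Nb i. zh i j (Suc t) \<omega> - y i (Suc t) \<omega>) \<in> borel_measurable (past T)"
      by (intro borel_measurable_sum borel_measurable_diff) auto
    then show ?thesis
      by (subst measurable_cong[where g = "\<lambda>\<omega>. y i (Suc t) \<omega> + \<gamma> / real (Suc (Suc t)) *
           (\<Sum>j \<in> Nb i. zh i j (Suc t) \<omega> - y i (Suc t) \<omega>)"])
        (use y_step i step in auto)
  qed
  ultimately show ?case by blast
qed

lemma zh_measurable: "t \<ge> t0 \<Longrightarrow> (i, j) \<in> pairs N Nb \<Longrightarrow> zh i j t \<in> borel_measurable Pr"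
  using adapted[of t t] past_le by blast

lemma y_measurable: "t \<ge> Suc t0 \<Longrightarrow> i \<in> {1..N} \<Longrightarrow> y i t \<in> borel_measurable Pr"
  using adapted[of "t - 1" "t - 1"] by (cases t) (auto intro: past_le)

lemma noise_cdf:
  assumes "(i, j) \<in> pairs N Nb"
  shows "cdf (distr Pr borel (d i j t)) = gauss_cdf \<sigma>"
proof -
  have "distr Pr lborel (d i j t) = density lborel (\<lambda>y. ennreal (normal_density 0 \<sigma> y))"
    using noise_gauss[OF assms] by (rule distributed_distr_eq_density)
  moreover have "distr Pr borel (d i j t) = distr Pr lborel (d i j t)"
    by (intro distr_cong) auto
  ultimately show ?thesis by (simp add: gauss_cdf_def)
qed

text \<open>The bit of time \<open>Suc t\<close> measures \<open>y j (Suc t)\<close>, which is known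
  from the past, through a noise whose index lies outside \<open>past_idx t\<close> and which is
  therefore independent of both factors.\<close>

lemma innovation_zero_mean:
  assumes "(i, j) \<in> pairs N Nb" "t \<ge> t0"
  shows "expectation (\<lambda>\<omega>. (zh i j t \<omega> - y j (Suc t) \<omega>) *
     ((if y j (Suc t) \<omega> + d i j (Suc t) \<omega> \<le> c i j then 1 else 0) - gauss_cdf \<sigma> (c i j - y j (Suc t) \<omega>))) = 0"
proof -
  have j: "j \<in> {1..N}" using pairs_in(2)[OF graph assms(1)] by simp
  have [measurable]: "zh i j t \<in> borel_measurable (past t)" "y j (Suc t) \<in> borel_measurable (past t)"
    using adapted[of t t] assms j by auto
  let ?k = "(i, j, Suc t)"
  have "indep_var (borel \<Otimes>\<^sub>M borel) (\<lambda>\<omega>. (zh i j t \<omega> - y j (Suc t) \<omega>, y j (Suc t) \<omega>))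
          (borel \<Otimes>\<^sub>M borel) (\<lambda>\<omega>. (d i j (Suc t) \<omega>, 0 :: real))"
  proof (rule indep_var_past[OF noise_indep, folded noise_def])
    show "past_idx t \<inter> {?k} = {}" "past_idx t \<subseteq> {(i, j, t). (i, j) \<in> pairs N Nb}"
      "{?k} \<subseteq> {(i, j, t). (i, j) \<in> pairs N Nb}"
      using assms by (auto simp: past_idx_def)
    show "(\<lambda>\<omega>. (zh i j t \<omega> - y j (Suc t) \<omega>, y j (Suc t) \<omega>))
      \<in> measurable (vimage_algebra (space Pr) (\<lambda>\<omega>. \<lambda>k\<in>past_idx t. noise k \<omega>) (PiM (past_idx t) (\<lambda>_. borel)))
          (borel \<Otimes>\<^sub>M borel)"
      unfolding past_def[symmetric] by measurable
    have "noise ?k \<in> borel_measurable (vimage_algebra (space Pr) (\<lambda>\<omega>. \<lambda>k\<in>{?k}. noise k \<omega>) (PiM {?k} (\<lambda>_. borel)))"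
      by (rule measurable_past_component) simp
    then show "(\<lambda>\<omega>. (d i j (Suc t) \<omega>, 0 :: real))
      \<in> measurable (vimage_algebra (space Pr) (\<lambda>\<omega>. \<lambda>k\<in>{?k}. noise k \<omega>) (PiM {?k} (\<lambda>_. borel)))
          (borel \<Otimes>\<^sub>M borel)"
      by (intro measurable_Pair measurable_const) (simp_all add: noise_def)
  qed
  moreover have "\<bar>zh i j t \<omega> - y j (Suc t) \<omega>\<bar> \<le> 2 * Mb" if "\<omega> \<in> space Pr" for \<omega>
    using zh_bound[OF that assms(2,1)] y_bound[OF that _ j, of "Suc t"] assms(2) by simp
  ultimately show ?thesis
    using threshold_zero_mean[of "\<lambda>\<omega>. zh i j t \<omega> - y j (Suc t) \<omega>" "y j (Suc t)" "d i j (Suc t)" "2 * Mb" "c i j"] M_pos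
    unfolding noise_cdf[OF assms(1)] by simp
qed

section \<open>Mean square quantities: bounds, measurability, integrability\<close>

definition dis :: "nat \<Rightarrow> nat \<Rightarrow> 'w \<Rightarrow> real" where
  "dis i t \<omega> = y i t \<omega> - (\<Sum>l\<in>{1..N}. y l t \<omega>) / real N"

definition err :: "nat \<times> nat \<Rightarrow> nat \<Rightarrow> 'w \<Rightarrow> real" where
  "err p t \<omega> = zh (fst p) (snd p) t \<omega> - y (snd p) t \<omega>"

text \<open>The estimation error against the target that has already moved, i.e. before the
  new bit is processed.\<close>

definition pre :: "nat \<times> nat \<Rightarrow> nat \<Rightarrow> 'w \<Rightarrow> real" where
  "pre p t \<omega> = zh (fst p) (snd p) t \<omega> - y (snd p) (Suc t) \<omega>"

definition drift :: "nat \<Rightarrow> nat \<Rightarrow> 'w \<Rightarrow> real" where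
  "drift i t \<omega> = (\<Sum>j\<in>Nb i. zh i j t \<omega> - y i t \<omega>)"

definition Vfun :: "nat \<Rightarrow> real" where
  "Vfun t = expectation (\<lambda>\<omega>. \<Sum>i\<in>{1..N}. (dis i t \<omega>)\<^sup>2)"

definition Rfun :: "nat \<Rightarrow> real" where
  "Rfun t = expectation (\<lambda>\<omega>. \<Sum>p\<in>pairs N Nb. (err p t \<omega>)\<^sup>2)"

lemma integrable_bounded:
  fixes f :: "'w \<Rightarrow> real"
  assumes "f \<in> borel_measurable Pr" "\<And>\<omega>. \<omega> \<in> space Pr \<Longrightarrow> \<bar>f \<omega>\<bar> \<le> K"
  shows "integrable Pr f"
  by (rule integrable_const_bound[of _ K]) (use assms in auto)

lemma square_le_bound: "\<bar>a\<bar> \<le> K \<Longrightarrow> a\<^sup>2 \<le> K\<^sup>2" for a K :: real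
  using power_mono[of "\<bar>a\<bar>" K 2] by simp

lemma integrable_square:
  fixes f :: "'w \<Rightarrow> real"
  assumes "f \<in> borel_measurable Pr" "\<And>\<omega>. \<omega> \<in> space Pr \<Longrightarrow> \<bar>f \<omega>\<bar> \<le> K"
  shows "integrable Pr (\<lambda>\<omega>. (f \<omega>)\<^sup>2)"
proof (rule integrable_bounded[of _ "K\<^sup>2"])
  show "(\<lambda>\<omega>. (f \<omega>)\<^sup>2) \<in> borel_measurable Pr" using assms(1) by measurable
qed (use assms(2) square_le_bound in auto)

lemma dis_bound:
  assumes "\<omega> \<in> space Pr" "t \<ge> Suc t0" "i \<in> {1..N}"
  shows "\<bar>dis i t \<omega>\<bar> \<le> 2 * Mb"
proof -
  have "\<bar>\<Sum>l\<in>{1..N}. y l t \<omega>\<bar> \<le> (\<Sum>l\<in>{1..N}. \<bar>y l t \<omega>\<bar>)" by (rule sum_abs)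
  also have "\<dots> \<le> (\<Sum>l\<in>{1..N}. Mb)" using assms by (intro sum_mono y_bound) auto
  finally have "\<bar>(\<Sum>l\<in>{1..N}. y l t \<omega>) / real N\<bar> \<le> Mb" using N2 by (simp add: field_simps)
  then show ?thesis unfolding dis_def using y_bound[OF assms] by linarith
qed

lemma err_bound:
  assumes "\<omega> \<in> space Pr" "t \<ge> Suc t0" "p \<in> pairs N Nb"
  shows "\<bar>err p t \<omega>\<bar> \<le> 2 * Mb"
  using zh_bound[OF assms(1), of t "fst p" "snd p"] y_bound[OF assms(1,2) pairs_in(2)[OF graph assms(3)]] assms
  by (simp add: err_def)

lemma pre_bound:
  assumes "\<omega> \<in> space Pr" "t \<ge> Suc t0" "p \<in> pairs N Nb"
  shows "\<bar>pre p t \<omega>\<bar> \<le> 2 * Mb"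
  using zh_bound[OF assms(1), of t "fst p" "snd p"]
    y_bound[OF assms(1) _ pairs_in(2)[OF graph assms(3)], of "Suc t"] assms
  by (simp add: pre_def)

lemma drift_bound:
  assumes "\<omega> \<in> space Pr" "t \<ge> Suc t0" "i \<in> {1..N}"
  shows "\<bar>drift i t \<omega>\<bar> \<le> 2 * Mb * real N"
proof -
  have "\<bar>drift i t \<omega>\<bar> \<le> (\<Sum>j\<in>Nb i. \<bar>zh i j t \<omega> - y i t \<omega>\<bar>)" unfolding drift_def by (rule sum_abs)
  also have "\<dots> \<le> (\<Sum>j\<in>Nb i. 2 * Mb)"
  proof (intro sum_mono)
    fix j assume "j \<in> Nb i"
    then show "\<bar>zh i j t \<omega> - y i t \<omega>\<bar> \<le> 2 * Mb"
      using zh_bound[OF assms(1) _ pair_mem[OF assms(3)], of t j] y_bound[OF assms] assms(2) by simp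
  qed
  also have "\<dots> \<le> 2 * Mb * real N" using card_Nb_le[OF assms(3)] M_pos by simp
  finally show ?thesis .
qed

lemma dis_measurable [measurable]:
  "t \<ge> Suc t0 \<Longrightarrow> i \<in> {1..N} \<Longrightarrow> dis i t \<in> borel_measurable Pr"
  unfolding dis_def
  by (intro borel_measurable_diff borel_measurable_divide borel_measurable_sum y_measurable borel_measurable_const) auto

lemma err_measurable: "t \<ge> Suc t0 \<Longrightarrow> p \<in> pairs N Nb \<Longrightarrow> err p t \<in> borel_measurable Pr"
  unfolding err_def using pairs_in(2)[OF graph]
  by (intro borel_measurable_diff zh_measurable y_measurable) auto

lemma pre_measurable: "t \<ge> Suc t0 \<Longrightarrow> p \<in> pairs N Nb \<Longrightarrow> pre p t \<in> borel_measurable Pr"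
  unfolding pre_def using pairs_in(2)[OF graph]
  by (intro borel_measurable_diff zh_measurable y_measurable) auto

lemma dis_integrable:
  "t \<ge> Suc t0 \<Longrightarrow> i \<in> {1..N} \<Longrightarrow> integrable Pr (\<lambda>\<omega>. (dis i t \<omega>)\<^sup>2)"
  by (rule integrable_square[OF dis_measurable dis_bound])

lemma err_integrable:
  "t \<ge> Suc t0 \<Longrightarrow> p \<in> pairs N Nb \<Longrightarrow> integrable Pr (\<lambda>\<omega>. (err p t \<omega>)\<^sup>2)"
  by (rule integrable_square[OF err_measurable err_bound])

lemma pre_integrable:
  "t \<ge> Suc t0 \<Longrightarrow> p \<in> pairs N Nb \<Longrightarrow> integrable Pr (\<lambda>\<omega>. (pre p t \<omega>)\<^sup>2)"
  by (rule integrable_square[OF pre_measurable pre_bound])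

lemma dis_sum_integrable: "t \<ge> Suc t0 \<Longrightarrow> integrable Pr (\<lambda>\<omega>. \<Sum>i\<in>{1..N}. (dis i t \<omega>)\<^sup>2)"
  by (intro Bochner_Integration.integrable_sum dis_integrable)

lemma err_sum_integrable: "t \<ge> Suc t0 \<Longrightarrow> integrable Pr (\<lambda>\<omega>. \<Sum>p\<in>pairs N Nb. (err p t \<omega>)\<^sup>2)"
  by (intro Bochner_Integration.integrable_sum err_integrable)

lemma pre_sum_integrable: "t \<ge> Suc t0 \<Longrightarrow> integrable Pr (\<lambda>\<omega>. \<Sum>p\<in>pairs N Nb. (pre p t \<omega>)\<^sup>2)"
  by (intro Bochner_Integration.integrable_sum pre_integrable)

lemma Vfun_nonneg: "Vfun t \<ge> 0" and Rfun_nonneg: "Rfun t \<ge> 0"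
  unfolding Vfun_def Rfun_def by (intro integral_nonneg_AE AE_I2 sum_nonneg; simp)+

lemma dis_le_Vfun:
  assumes "t \<ge> Suc t0" "i \<in> {1..N}"
  shows "expectation (\<lambda>\<omega>. (dis i t \<omega>)\<^sup>2) \<le> Vfun t"
  unfolding Vfun_def
  by (intro integral_mono dis_integrable dis_sum_integrable assms member_le_sum[OF assms(2)]) auto

lemma err_le_Rfun:
  assumes "t \<ge> Suc t0" "p \<in> pairs N Nb"
  shows "expectation (\<lambda>\<omega>. (err p t \<omega>)\<^sup>2) \<le> Rfun t"
  unfolding Rfun_def
  by (intro integral_mono err_integrable err_sum_integrable assms member_le_sum[OF assms(2)])
    (auto simp: finite_pairs[OF graph])

section \<open>One-step recursions for V and R\<close>

definition cV :: real where "cV = \<gamma>\<^sup>2 * (real N * (2 * Mb * real N)\<^sup>2)"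

text \<open>\<open>disagreement_step\<close> holds on every path with step size \<gamma> / (t + 1);
  taking expectations keeps it. The constant \<open>cV\<close> bounds the second-order term through
  the uniform bound on \<open>drift\<close>.\<close>

lemma Vfun_step:
  assumes t: "t \<ge> Suc t0"
  shows "Vfun (Suc t) \<le> Vfun t
    + (- (\<gamma> * lambda2 N Nb) * Vfun t + \<gamma> * lambdaG N Nb / lambda2 N Nb * Rfun t) / real (Suc t)
    + cV / (real (Suc t))\<^sup>2"
proof -
  define h where "h = \<gamma> / real (Suc t)"
  have h: "h \<ge> 0" using gamma_pos by (simp add: h_def)
  let ?D = "\<lambda>t \<omega>. \<Sum>i\<in>{1..N}. (dis i t \<omega>)\<^sup>2" and ?E = "\<lambda>\<omega>. \<Sum>p\<in>pairs N Nb. (err p t \<omega>)\<^sup>2"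
  let ?K = "real N * (2 * Mb * real N)\<^sup>2"
  have path: "?D (Suc t) \<omega> \<le> ?D t \<omega> + h * (- lambda2 N Nb * ?D t \<omega> + lambdaG N Nb / lambda2 N Nb * ?E \<omega>) + h\<^sup>2 * ?K"
    if \<omega>: "\<omega> \<in> space Pr" for \<omega>
  proof -
    have y': "y i (Suc t) \<omega> = y i t \<omega> + h * drift i t \<omega>" if "i \<in> {1..N}" for i
      using y_step[OF \<omega> t that] by (simp add: h_def drift_def)
    have "?D (Suc t) \<omega> = (\<Sum>i\<in>{1..N}. (y i t \<omega> + h * drift i t \<omega>
        - (\<Sum>l\<in>{1..N}. y l t \<omega> + h * drift l t \<omega>) / real N)\<^sup>2)"
      unfolding dis_def by (intro sum.cong refl) (simp add: y')
    also have "\<dots> \<le> ?D t \<omega> + h * (- lambda2 N Nb * ?D t \<omega> + lambdaG N Nb / lambda2 N Nb * ?E \<omega>)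
        + h\<^sup>2 * (\<Sum>i\<in>{1..N}. (drift i t \<omega>)\<^sup>2)"
      using disagreement_step[OF graph conn N2 h, of "\<lambda>i. y i t \<omega>" "\<lambda>p. zh (fst p) (snd p) t \<omega>"]
      unfolding dis_def err_def drift_def by simp
    also have "(\<Sum>i\<in>{1..N}. (drift i t \<omega>)\<^sup>2) \<le> (\<Sum>i\<in>{1..N}. (2 * Mb * real N)\<^sup>2)"
      by (intro sum_mono square_le_bound drift_bound[OF \<omega> t])
    finally show ?thesis by (simp add: mult_left_mono)
  qed
  have "Vfun (Suc t) \<le> expectation (\<lambda>\<omega>. ?D t \<omega>
      + h * (- lambda2 N Nb * ?D t \<omega> + lambdaG N Nb / lambda2 N Nb * ?E \<omega>) + h\<^sup>2 * ?K)"
    unfolding Vfun_def using t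
    by (intro integral_mono path Bochner_Integration.integrable_add integrable_mult_right
        dis_sum_integrable err_sum_integrable integrable_const) auto
  also have "\<dots> = Vfun t + h * (- lambda2 N Nb * Vfun t + lambdaG N Nb / lambda2 N Nb * Rfun t) + h\<^sup>2 * ?K"
    using dis_sum_integrable[OF t] err_sum_integrable[OF t]
    by (simp add: Vfun_def Rfun_def prob_space)
  also have "\<dots> = Vfun t
    + (- (\<gamma> * lambda2 N Nb) * Vfun t + \<gamma> * lambdaG N Nb / lambda2 N Nb * Rfun t) / real (Suc t)
    + cV / (real (Suc t))\<^sup>2"
    by (simp add: h_def cV_def power_divide add_divide_distrib diff_divide_distrib algebra_simps del: of_nat_Suc)
  finally show ?thesis .
qed

lemma fM_pos: "fM_const \<sigma> c Mb N Nb > 0"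
  unfolding fM_const_def using pairs_nonempty[OF graph conn N2] finite_pairs[OF graph] sigma_pos
  by (subst Min_gr_iff) (auto simp: gauss_pdf_def intro: normal_density_pos)

lemma fM_le: "(i, j) \<in> pairs N Nb \<Longrightarrow> fM_const \<sigma> c Mb N Nb \<le> gauss_pdf \<sigma> (\<bar>c i j\<bar> + Mb)"
  unfolding fM_const_def using finite_pairs[OF graph] by (intro Min_le) force+

text \<open>Projecting onto an interval that contains the target does not increase the error. In the
  expanded square, monotonicity of the distribution function gives the contraction, the innovation
  averages out, and the second-order term is at most (\<beta> / (t + 1))^2.\<close>

lemma err_step:
  assumes t: "t \<ge> Suc t0" and p: "p \<in> pairs N Nb"
  shows "expectation (\<lambda>\<omega>. (err p (Suc t) \<omega>)\<^sup>2) \<le> expectation (\<lambda>\<omega>. (pre p t \<omega>)\<^sup>2)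
    - 2 * \<beta> * fM_const \<sigma> c Mb N Nb / real (Suc t) * expectation (\<lambda>\<omega>. (pre p t \<omega>)\<^sup>2) + \<beta>\<^sup>2 / (real (Suc t))\<^sup>2"
proof -
  obtain i j where ij: "p = (i, j)" by (cases p)
  have P: "(i, j) \<in> pairs N Nb" using p ij by simp
  have j: "j \<in> {1..N}" using pairs_in(2)[OF graph P] by simp
  define b where "b = \<beta> / real (Suc t)"
  have b: "b > 0" using beta_pos by (simp add: b_def)
  let ?f = "fM_const \<sigma> c Mb N Nb"
  let ?F = "\<lambda>x. gauss_cdf \<sigma> (c i j - x)"
  let ?s = "\<lambda>\<omega>. if y j (Suc t) \<omega> + d i j (Suc t) \<omega> \<le> c i j then 1 else 0 :: real"
  let ?g = "\<lambda>\<omega>. pre p t \<omega> * (?s \<omega> - ?F (y j (Suc t) \<omega>))"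
  have path: "(err p (Suc t) \<omega>)\<^sup>2 \<le> (pre p t \<omega>)\<^sup>2 - 2 * b * ?f * (pre p t \<omega>)\<^sup>2 - 2 * b * ?g \<omega> + b\<^sup>2"
    if \<omega>: "\<omega> \<in> space Pr" for \<omega>
  proof -
    define u where "u = zh i j t \<omega>"
    define v where "v = y j (Suc t) \<omega>"
    have uv: "\<bar>u\<bar> \<le> Mb" "\<bar>v\<bar> \<le> Mb"
      using zh_bound[OF \<omega> _ P, of t] y_bound[OF \<omega> _ j, of "Suc t"] t by (auto simp: u_def v_def)
    have "(err p (Suc t) \<omega>)\<^sup>2 = (projM Mb (u + b * (?F u - ?s \<omega>)) - v)\<^sup>2"
      using z_step[OF \<omega> _ P, of t] t by (simp add: err_def ij u_def v_def b_def)
    also have "\<dots> \<le> (u + b * (?F u - ?s \<omega>) - v)\<^sup>2"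
      by (rule projM_nonexpansive[OF uv(2)])
    \<comment> \<open>The correction F(c - u) - s is split at F(c - v), into a deterministic
      restoring part and the centred innovation.\<close>
    also have "\<dots> = (u - v)\<^sup>2 + 2 * b * ((u - v) * (?F u - ?F v)) - 2 * b * ((u - v) * (?s \<omega> - ?F v))
        + b\<^sup>2 * (?F u - ?s \<omega>)\<^sup>2"
      by (simp add: power2_eq_square algebra_simps)
    also have "\<dots> \<le> (u - v)\<^sup>2 + 2 * b * (- ?f * (u - v)\<^sup>2) - 2 * b * ((u - v) * (?s \<omega> - ?F v)) + b\<^sup>2 * 1"
    proof -
      have "(u - v) * (?F u - ?F v) \<le> - gauss_pdf \<sigma> (\<bar>c i j\<bar> + Mb) * (u - v)\<^sup>2"
        by (rule gauss_cdf_strongly_monotone[OF sigma_pos uv])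
      also have "\<dots> \<le> - ?f * (u - v)\<^sup>2" using fM_le[OF P] by (simp add: mult_right_mono)
      finally have "2 * b * ((u - v) * (?F u - ?F v)) \<le> 2 * b * (- ?f * (u - v)\<^sup>2)"
        using b by (intro mult_left_mono) auto
      moreover have "\<bar>?F u - ?s \<omega>\<bar> \<le> 1" using gauss_cdf_bounds[OF sigma_pos, of "c i j - u"] by auto
      then have "b\<^sup>2 * (?F u - ?s \<omega>)\<^sup>2 \<le> b\<^sup>2 * 1" by (intro mult_left_mono) (auto simp: abs_square_le_1)
      ultimately show ?thesis by linarith
    qed
    finally show ?thesis by (simp add: pre_def ij u_def v_def algebra_simps)
  qed
  have [measurable]: "y j (Suc t) \<in> borel_measurable Pr" "d i j (Suc t) \<in> borel_measurable Pr"
      "pre p t \<in> borel_measurable Pr" "gauss_cdf \<sigma> \<in> borel_measurable borel"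
    using y_measurable[OF _ j, of "Suc t"] t noise_rv[of "(i, j, Suc t)"] P pre_measurable[OF t p]
      gauss_cdf_measurable[OF sigma_pos] by (auto simp: noise_def)
  have gint: "integrable Pr ?g"
  proof (rule integrable_bounded[of _ "2 * Mb"])
    show "?g \<in> borel_measurable Pr" by measurable
    fix \<omega> assume \<omega>: "\<omega> \<in> space Pr"
    have "\<bar>?s \<omega> - ?F (y j (Suc t) \<omega>)\<bar> \<le> 1"
      using gauss_cdf_bounds[OF sigma_pos, of "c i j - y j (Suc t) \<omega>"] by auto
    then show "\<bar>?g \<omega>\<bar> \<le> 2 * Mb"
      using mult_mono[OF pre_bound[OF \<omega> t p], of "\<bar>?s \<omega> - ?F (y j (Suc t) \<omega>)\<bar>" 1] M_pos
      by (simp add: abs_mult)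
  qed
  have g0: "expectation ?g = 0"
    using innovation_zero_mean[OF P, of t] t by (simp add: pre_def ij)
  have "expectation (\<lambda>\<omega>. (err p (Suc t) \<omega>)\<^sup>2)
      \<le> expectation (\<lambda>\<omega>. (pre p t \<omega>)\<^sup>2 - 2 * b * ?f * (pre p t \<omega>)\<^sup>2 - 2 * b * ?g \<omega> + b\<^sup>2)"
    by (rule integral_mono) (use path gint pre_integrable[OF t p] err_integrable[OF _ p, of "Suc t"] t in auto)
  also have "\<dots> = expectation (\<lambda>\<omega>. (pre p t \<omega>)\<^sup>2) - 2 * b * ?f * expectation (\<lambda>\<omega>. (pre p t \<omega>)\<^sup>2)
      - 2 * b * expectation ?g + b\<^sup>2"
    using gint pre_integrable[OF t p] by (simp add: prob_space)
  finally show ?thesis unfolding g0 by (simp add: b_def power_divide algebra_simps)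
qed

text \<open>Three second-order costs per pair: the squared motion of the target, the replacement of
  \<open>pre\<close> by \<open>err\<close> inside the contraction term, and the squared estimation
  step.\<close>

definition cR :: real where
  "cR = real (card (pairs N Nb)) * (\<gamma>\<^sup>2 * (2 * Mb * real N)\<^sup>2
      + 2 * \<beta> * fM_const \<sigma> c Mb N Nb * (2 * \<gamma> * (2 * Mb) * (2 * Mb * real N)) + \<beta>\<^sup>2)"

text \<open>One time step has two stages: the target moves, which turns \<open>err\<close> into
  \<open>pre\<close> and is bounded by \<open>estimate_step\<close>, and then the new bit is
  processed, which contracts \<open>pre\<close> by \<open>err_step\<close>.\<close>

lemma Rfun_step:
  assumes t: "t \<ge> Suc t0"
  shows "Rfun (Suc t) \<le> Rfun t
    + (\<gamma> * lambdaG N Nb / lambda2 N Nb * Vfun t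
       - (2 * \<beta> * fM_const \<sigma> c Mb N Nb - \<gamma> * alpha_const N Nb) * Rfun t) / real (Suc t)
    + cR / (real (Suc t))\<^sup>2"
proof -
  define s where "s = real (Suc t)"
  have s: "s > 0" by (simp add: s_def)
  define h where "h = \<gamma> / s"
  have h: "h \<ge> 0" using gamma_pos s by (simp add: h_def)
  let ?f = "fM_const \<sigma> c Mb N Nb" and ?P = "pairs N Nb"
  let ?D = "\<lambda>\<omega>. \<Sum>i\<in>{1..N}. (dis i t \<omega>)\<^sup>2" and ?E = "\<lambda>\<omega>. \<Sum>p\<in>?P. (err p t \<omega>)\<^sup>2"
  define W where "W = 2 * Mb * real N"
  define H where "H = expectation (\<lambda>\<omega>. \<Sum>p\<in>?P. (pre p t \<omega>)\<^sup>2)"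
  have pre_err: "pre p t \<omega> = err p t \<omega> - h * drift (snd p) t \<omega>" if "\<omega> \<in> space Pr" "p \<in> ?P" for \<omega> p
    using y_step[OF that(1) t pairs_in(2)[OF graph that(2)]] by (simp add: pre_def err_def h_def s_def drift_def)
  have up: "(\<Sum>p\<in>?P. (pre p t \<omega>)\<^sup>2) \<le> ?E \<omega> + h * (alpha_const N Nb * ?E \<omega> + lambdaG N Nb / lambda2 N Nb * ?D \<omega>)
      + h\<^sup>2 * (real (card ?P) * W\<^sup>2)" if \<omega>: "\<omega> \<in> space Pr" for \<omega>
  proof -
    have "(\<Sum>p\<in>?P. (pre p t \<omega>)\<^sup>2)
        = (\<Sum>p\<in>?P. (zh (fst p) (snd p) t \<omega> - (y (snd p) t \<omega> + h * drift (snd p) t \<omega>))\<^sup>2)"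
      by (intro sum.cong refl) (simp add: pre_err[OF \<omega>] err_def diff_diff_eq)
    also have "\<dots> \<le> ?E \<omega> + h * (alpha_const N Nb * ?E \<omega> + lambdaG N Nb / lambda2 N Nb * ?D \<omega>)
        + h\<^sup>2 * (\<Sum>p\<in>?P. (drift (snd p) t \<omega>)\<^sup>2)"
      using estimate_step[OF graph conn N2 h, of "\<lambda>p. zh (fst p) (snd p) t \<omega>" "\<lambda>i. y i t \<omega>"]
      unfolding dis_def err_def drift_def by simp
    also have "(\<Sum>p\<in>?P. (drift (snd p) t \<omega>)\<^sup>2) \<le> (\<Sum>p\<in>?P. W\<^sup>2)"
      unfolding W_def by (intro sum_mono square_le_bound drift_bound[OF \<omega> t] pairs_in(2)[OF graph])
    finally show ?thesis by (simp add: mult_left_mono)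
  qed
  \<comment> \<open>A lower bound for \<open>H\<close> is needed too: in
    \<open>H - 2 * \<beta> * ?f / s * H\<close> the two occurrences are bounded from opposite sides,
    which is valid whatever the sign of the total factor. The loss of order \<open>h\<close> becomes
    of order 1 / s^2 after the multiplication by 1 / s.\<close>
  have lo: "?E \<omega> - real (card ?P) * (2 * h * (2 * Mb) * W) \<le> (\<Sum>p\<in>?P. (pre p t \<omega>)\<^sup>2)" if \<omega>: "\<omega> \<in> space Pr" for \<omega>
  proof -
    have "(err p t \<omega>)\<^sup>2 - 2 * h * (2 * Mb) * W \<le> (pre p t \<omega>)\<^sup>2" if p: "p \<in> ?P" for p
    proof -
      have "err p t \<omega> * drift (snd p) t \<omega> \<le> \<bar>err p t \<omega>\<bar> * \<bar>drift (snd p) t \<omega>\<bar>"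
        by (simp add: abs_mult[symmetric])
      also have "\<dots> \<le> (2 * Mb) * W"
        unfolding W_def using M_pos
        by (intro mult_mono err_bound[OF \<omega> t p] drift_bound[OF \<omega> t pairs_in(2)[OF graph p]]) auto
      finally have "2 * h * (err p t \<omega> * drift (snd p) t \<omega>) \<le> 2 * h * ((2 * Mb) * W)"
        using h by (intro mult_left_mono) auto
      moreover have "(pre p t \<omega>)\<^sup>2 = (err p t \<omega>)\<^sup>2 - 2 * h * (err p t \<omega> * drift (snd p) t \<omega>) + (h * drift (snd p) t \<omega>)\<^sup>2"
        unfolding pre_err[OF \<omega> p] by (simp add: power2_eq_square algebra_simps)
      ultimately show ?thesis
        using zero_le_power2[of "h * drift (snd p) t \<omega>"] unfolding mult.assoc by linarith
    qed
    then have "(\<Sum>p\<in>?P. (err p t \<omega>)\<^sup>2 - 2 * h * (2 * Mb) * W) \<le> (\<Sum>p\<in>?P. (pre p t \<omega>)\<^sup>2)"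
      by (rule sum_mono)
    then show ?thesis by (simp add: sum_subtractf)
  qed
  note ints = dis_sum_integrable[OF t] err_sum_integrable[OF t] pre_sum_integrable[OF t]
  have "H \<le> expectation (\<lambda>\<omega>. ?E \<omega> + h * (alpha_const N Nb * ?E \<omega> + lambdaG N Nb / lambda2 N Nb * ?D \<omega>)
      + h\<^sup>2 * (real (card ?P) * W\<^sup>2))"
    unfolding H_def by (intro integral_mono up ints Bochner_Integration.integrable_add integrable_mult_right
        integrable_const)
  also have "\<dots> = Rfun t + h * (alpha_const N Nb * Rfun t + lambdaG N Nb / lambda2 N Nb * Vfun t)
      + h\<^sup>2 * (real (card ?P) * W\<^sup>2)"
    using ints by (simp add: Vfun_def Rfun_def prob_space)
  finally have Hup: "H \<le> Rfun t + h * (alpha_const N Nb * Rfun t + lambdaG N Nb / lambda2 N Nb * Vfun t)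
      + h\<^sup>2 * (real (card ?P) * W\<^sup>2)" .
  have "Rfun t - real (card ?P) * (2 * h * (2 * Mb) * W) = expectation (\<lambda>\<omega>. ?E \<omega> - real (card ?P) * (2 * h * (2 * Mb) * W))"
    using ints by (simp add: Rfun_def prob_space)
  also have "\<dots> \<le> H"
    unfolding H_def by (intro integral_mono lo ints Bochner_Integration.integrable_diff integrable_const)
  finally have Hlo: "Rfun t - real (card ?P) * (2 * h * (2 * Mb) * W) \<le> H" .
  have "Rfun (Suc t) = (\<Sum>p\<in>?P. expectation (\<lambda>\<omega>. (err p (Suc t) \<omega>)\<^sup>2))"
    unfolding Rfun_def using t by (intro Bochner_Integration.integral_sum err_integrable) auto
  also have "\<dots> \<le> (\<Sum>p\<in>?P. expectation (\<lambda>\<omega>. (pre p t \<omega>)\<^sup>2)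
    - 2 * \<beta> * ?f / s * expectation (\<lambda>\<omega>. (pre p t \<omega>)\<^sup>2) + \<beta>\<^sup>2 / s\<^sup>2)"
    unfolding s_def by (intro sum_mono err_step[OF t])
  also have "\<dots> = H - 2 * \<beta> * ?f / s * H + real (card ?P) * \<beta>\<^sup>2 / s\<^sup>2"
    using Bochner_Integration.integral_sum[of ?P Pr "\<lambda>p \<omega>. (pre p t \<omega>)\<^sup>2"] pre_integrable[OF t]
    by (simp add: H_def sum.distrib sum_subtractf sum_distrib_left)
  also have "\<dots> \<le> (Rfun t + h * (alpha_const N Nb * Rfun t + lambdaG N Nb / lambda2 N Nb * Vfun t)
      + h\<^sup>2 * (real (card ?P) * W\<^sup>2))
      - 2 * \<beta> * ?f / s * (Rfun t - real (card ?P) * (2 * h * (2 * Mb) * W)) + real (card ?P) * \<beta>\<^sup>2 / s\<^sup>2"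
    using beta_pos fM_pos s Hlo by (intro add_right_mono diff_mono Hup mult_left_mono) auto
  also have "\<dots> = Rfun t
    + (\<gamma> * lambdaG N Nb / lambda2 N Nb * Vfun t - (2 * \<beta> * ?f - \<gamma> * alpha_const N Nb) * Rfun t) / s
    + cR / s\<^sup>2"
    unfolding cR_def W_def[symmetric] h_def
    by (simp add: power_divide add_divide_distrib diff_divide_distrib power2_eq_square algebra_simps)
  finally show ?thesis by (simp add: s_def)
qed

section \<open>Lyapunov decay and the two mean square conclusions\<close>

lemma lyapunov:
  assumes "\<gamma> * lambda2 N Nb > \<kappa>0"
    and "2 * \<beta> * fM_const \<sigma> c Mb N Nb - \<gamma> * alpha_const N Nb
      > (\<gamma> * lambdaG N Nb / lambda2 N Nb)\<^sup>2 / (\<gamma> * lambda2 N Nb - \<kappa>0) + \<kappa>0"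
  shows "\<exists>p>0. \<exists>\<kappa>>\<kappa>0. \<exists>C\<ge>0. \<forall>t\<ge>Suc t0. p * Vfun (Suc t) + Rfun (Suc t)
       \<le> (1 - \<kappa> / real (Suc t)) * (p * Vfun t + Rfun t) + C / (real (Suc t))\<^sup>2"
proof -
  let ?C = "max cV cR"
  have C0: "?C \<ge> 0" by (simp add: cV_def le_max_iff_disj)
  have q: "\<gamma> * lambdaG N Nb / lambda2 N Nb > 0"
    using gamma_pos lambdaG_pos[OF graph conn N2] lambda2_pos[OF graph conn N2] by simp
  have le: "x + cV / (real (Suc t))\<^sup>2 \<le> x + ?C / (real (Suc t))\<^sup>2" "x + cR / (real (Suc t))\<^sup>2 \<le> x + ?C / (real (Suc t))\<^sup>2" for x t
    by (intro add_left_mono divide_right_mono; simp)+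
  show ?thesis
  proof (rule coupled_lyapunov[where V = Vfun and R = Rfun and T = "Suc t0" and C = ?C,
        OF order_trans[OF Vfun_step le(1)] order_trans[OF Rfun_step le(2)] Vfun_nonneg Rfun_nonneg q C0 assms])
    fix p \<kappa> assume p: "p > 0" "\<kappa> > \<kappa>0"
      and "\<And>t. t \<ge> Suc t0 \<Longrightarrow> p * Vfun (Suc t) + Rfun (Suc t)
       \<le> (1 - \<kappa> / real (Suc t)) * (p * Vfun t + Rfun t) + (p + 1) * ?C / (real (Suc t))\<^sup>2"
    moreover have "(p + 1) * ?C \<ge> 0" using p C0 by simp
    ultimately show ?thesis by blast
  qed
qed

text \<open>Multiplied by \<open>2 * fM_const \<sigma> c Mb N Nb\<close>, the condition on \<beta>
  is the gap condition of \<open>lyapunov\<close> at \<open>\<kappa>0 = 0\<close>. Each single mean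
  square is then dominated by the Lyapunov function or by its quotient by \<open>p\<close>.\<close>

lemma mean_square_convergence:
  assumes "\<beta> > 1 / (2 * fM_const \<sigma> c Mb N Nb) *
      (\<gamma> * (lambdaG N Nb)\<^sup>2 / (lambda2 N Nb) ^ 3 + \<gamma> * alpha_const N Nb)"
  shows "i \<in> {1..N} \<Longrightarrow> (\<lambda>t. expectation (\<lambda>\<omega>. (dis i t \<omega>)\<^sup>2)) \<longlonglongrightarrow> 0"
    and "p \<in> pairs N Nb \<Longrightarrow> (\<lambda>t. expectation (\<lambda>\<omega>. (err p t \<omega>)\<^sup>2)) \<longlonglongrightarrow> 0"
proof -
  let ?f = "fM_const \<sigma> c Mb N Nb"
  have l2: "lambda2 N Nb > 0" by (rule lambda2_pos[OF graph conn N2])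
  have eq: "(\<gamma> * lambdaG N Nb / lambda2 N Nb)\<^sup>2 / (\<gamma> * lambda2 N Nb - 0) = \<gamma> * (lambdaG N Nb)\<^sup>2 / (lambda2 N Nb) ^ 3"
    using l2 gamma_pos by (simp add: field_simps power2_eq_square power3_eq_cube)
  have "2 * ?f * \<beta> > \<gamma> * (lambdaG N Nb)\<^sup>2 / (lambda2 N Nb) ^ 3 + \<gamma> * alpha_const N Nb"
    using assms fM_pos by (simp add: pos_divide_less_eq mult.commute)
  then have gap: "2 * \<beta> * ?f - \<gamma> * alpha_const N Nb
      > (\<gamma> * lambdaG N Nb / lambda2 N Nb)\<^sup>2 / (\<gamma> * lambda2 N Nb - 0) + 0"
    unfolding eq by (simp add: mult_ac)
  have "\<gamma> * lambda2 N Nb > 0" using l2 gamma_pos by simp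
  then obtain p \<kappa> C where p: "p > 0" and k: "\<kappa> > 0" "C \<ge> 0"
    and rec: "\<And>t. t \<ge> Suc t0 \<Longrightarrow> p * Vfun (Suc t) + Rfun (Suc t)
       \<le> (1 - \<kappa> / real (Suc t)) * (p * Vfun t + Rfun t) + C / (real (Suc t))\<^sup>2" using lyapunov[OF _ gap] by blast
  have U: "(\<lambda>t. p * Vfun t + Rfun t) \<longlonglongrightarrow> 0"
    by (rule recursion_tendsto_zero[OF rec _ k]) (use p Vfun_nonneg Rfun_nonneg in auto)
  have V: "Vfun t \<le> (p * Vfun t + Rfun t) / p" and R: "Rfun t \<le> p * Vfun t + Rfun t" for t
    using p Vfun_nonneg[of t] Rfun_nonneg[of t] by (auto simp: field_simps)
  have Up: "(\<lambda>t. (p * Vfun t + Rfun t) / p) \<longlonglongrightarrow> 0"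
    using tendsto_divide[OF U tendsto_const[of p]] p by simp
  show "(\<lambda>t. expectation (\<lambda>\<omega>. (dis i t \<omega>)\<^sup>2)) \<longlonglongrightarrow> 0" if "i \<in> {1..N}"
    by (rule tendsto_sandwich[OF _ _ tendsto_const Up])
      (use order_trans[OF dis_le_Vfun[OF _ that] V] in \<open>auto simp: eventually_sequentially\<close>)
  show "(\<lambda>t. expectation (\<lambda>\<omega>. (err p t \<omega>)\<^sup>2)) \<longlonglongrightarrow> 0" if "p \<in> pairs N Nb" for p
    by (rule tendsto_sandwich[OF _ _ tendsto_const U])
      (use order_trans[OF err_le_Rfun[OF _ that] R] in \<open>auto simp: eventually_sequentially\<close>)
qed

text \<open>The same argument at \<open>\<kappa>0 = 1\<close>, where the condition on \<gamma> says
  that \<open>\<gamma> * lambda2 N Nb\<close> exceeds 1; the resulting decay rate above 1 is what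
  \<open>recursion_rate\<close> requires.\<close>

lemma mean_square_rate:
  assumes "\<gamma> > 1 / lambda2 N Nb"
    and "\<beta> > 1 / (2 * fM_const \<sigma> c Mb N Nb) *
      (\<gamma>\<^sup>2 * (lambdaG N Nb)\<^sup>2 / ((lambda2 N Nb)\<^sup>2 * (\<gamma> * lambda2 N Nb - 1)) + \<gamma> * alpha_const N Nb + 1)"
  shows "\<exists>C>0. \<forall>t\<ge>Suc t0. (\<forall>i\<in>{1..N}. expectation (\<lambda>\<omega>. (dis i t \<omega>)\<^sup>2) \<le> C / real t)
    \<and> (\<forall>p\<in>pairs N Nb. expectation (\<lambda>\<omega>. (err p t \<omega>)\<^sup>2) \<le> C / real t)"
proof -
  let ?f = "fM_const \<sigma> c Mb N Nb"
  have l2: "lambda2 N Nb > 0" by (rule lambda2_pos[OF graph conn N2])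
  have g: "\<gamma> * lambda2 N Nb > 1" using assms(1) l2 by (simp add: field_simps)
  have eq: "(\<gamma> * lambdaG N Nb / lambda2 N Nb)\<^sup>2 / (\<gamma> * lambda2 N Nb - 1)
      = \<gamma>\<^sup>2 * (lambdaG N Nb)\<^sup>2 / ((lambda2 N Nb)\<^sup>2 * (\<gamma> * lambda2 N Nb - 1))"
    by (simp add: power_divide power_mult_distrib)
  have "2 * ?f * \<beta> > \<gamma>\<^sup>2 * (lambdaG N Nb)\<^sup>2 / ((lambda2 N Nb)\<^sup>2 * (\<gamma> * lambda2 N Nb - 1)) + \<gamma> * alpha_const N Nb + 1"
    using assms(2) fM_pos by (simp add: pos_divide_less_eq mult.commute)
  then have gap: "2 * \<beta> * ?f - \<gamma> * alpha_const N Nb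
      > (\<gamma> * lambdaG N Nb / lambda2 N Nb)\<^sup>2 / (\<gamma> * lambda2 N Nb - 1) + 1"
    unfolding eq by (simp add: mult_ac)
  obtain p \<kappa> C where p: "p > 0" and k: "\<kappa> > 1" "C \<ge> 0"
    and rec: "\<And>t. t \<ge> Suc t0 \<Longrightarrow> p * Vfun (Suc t) + Rfun (Suc t)
       \<le> (1 - \<kappa> / real (Suc t)) * (p * Vfun t + Rfun t) + C / (real (Suc t))\<^sup>2" using lyapunov[OF g gap] by blast
  obtain K where K: "K > 0" and U: "\<And>t. t \<ge> Suc t0 \<Longrightarrow> p * Vfun t + Rfun t \<le> K / real t"
    using recursion_rate[of "Suc t0" "\<lambda>t. p * Vfun t + Rfun t", OF rec _ k] by auto
  define C' where "C' = max K (K / p)"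
  have C': "C' > 0" "K \<le> C'" "K / p \<le> C'" using K by (auto simp: C'_def)
  have "Vfun t \<le> C' / real t" "Rfun t \<le> C' / real t" if t: "t \<ge> Suc t0" for t
  proof -
    have "p * Vfun t \<le> K / real t" using U[OF t] Rfun_nonneg[of t] by linarith
    then have "Vfun t \<le> (K / real t) / p"
      using p by (subst pos_le_divide_eq) (simp_all add: mult.commute)
    also have "\<dots> = (K / p) / real t" by simp
    also have "\<dots> \<le> C' / real t" by (intro divide_right_mono C'(3)) simp
    finally show "Vfun t \<le> C' / real t" .
    have "p * Vfun t \<ge> 0" using p Vfun_nonneg[of t] by simp
    then have "Rfun t \<le> K / real t" using U[OF t] by linarith
    also have "\<dots> \<le> C' / real t" by (intro divide_right_mono C'(2)) simp
    finally show "Rfun t \<le> C' / real t" .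
  qed
  then have "\<forall>t\<ge>Suc t0. (\<forall>i\<in>{1..N}. expectation (\<lambda>\<omega>. (dis i t \<omega>)\<^sup>2) \<le> C' / real t)
    \<and> (\<forall>p\<in>pairs N Nb. expectation (\<lambda>\<omega>. (err p t \<omega>)\<^sup>2) \<le> C' / real t)"
    by (blast intro: order_trans[OF dis_le_Vfun] order_trans[OF err_le_Rfun])
  then show ?thesis using C'(1) by blast
qed

end

section \<open>Reduction of the vector system to the scalar one\<close>

theorem theorem1:
  fixes n N :: nat
    and a b :: "nat \<Rightarrow> real"
    and Nb :: "nat \<Rightarrow> nat set"
    and c :: "nat \<Rightarrow> nat \<Rightarrow> real"
    and \<sigma> \<beta> \<gamma> Mb :: real
    and t0 :: nat
    and x0 :: "nat \<Rightarrow> nat \<Rightarrow> real"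
    and z0 :: "nat \<Rightarrow> nat \<Rightarrow> real"
    and Pr :: "'w measure"
    and d :: "nat \<Rightarrow> nat \<Rightarrow> nat \<Rightarrow> 'w \<Rightarrow> real"
    and x :: "nat \<Rightarrow> nat \<Rightarrow> 'w \<Rightarrow> nat \<Rightarrow> real"
    and zh :: "nat \<Rightarrow> nat \<Rightarrow> nat \<Rightarrow> 'w \<Rightarrow> real"
  assumes n2: "n \<ge> 2" and N2: "N \<ge> 2"
    and graph: "undirected_graph N Nb" and conn: "graph_connected N Nb"
    and sigma_pos: "\<sigma> > 0" and beta_pos: "\<beta> > 0" and gamma_pos: "\<gamma> > 0"
    and t0_bound: "real t0 > \<gamma> * real (dmax N Nb) - 1"
    and M_pos: "Mb > 0"
    and x0_bound: "\<forall>i \<in> {1..N}. \<bar>rowmul n (K2coef n b) (x0 i)\<bar> \<le> Mb"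
    and z0_bound: "\<forall>i \<in> {1..N}. \<forall>j \<in> Nb i. \<bar>z0 i j\<bar> \<le> Mb"
    and prob: "prob_space Pr"
    and noise_indep: "prob_space.indep_vars Pr (\<lambda>_. borel)
                        (\<lambda>(i, j, t). d i j t) {(i, j, t). (i, j) \<in> pairs N Nb}"
    and noise_gauss: "\<forall>i j t. (i, j) \<in> pairs N Nb \<longrightarrow>
                        distributed Pr lborel (d i j t) (\<lambda>y. ennreal (normal_density 0 \<sigma> y))"
    and x_init: "\<forall>\<omega> \<in> space Pr. \<forall>i \<in> {1..N}. \<forall>k \<in> {1..n}. x i (t0 + 1) \<omega> k = x0 i k"
    and z_init: "\<forall>\<omega> \<in> space Pr. \<forall>i \<in> {1..N}. \<forall>j \<in> Nb i. zh i j t0 \<omega> = z0 i j"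
    and z_step: "\<forall>\<omega> \<in> space Pr. \<forall>t \<ge> t0 + 1. \<forall>i \<in> {1..N}. \<forall>j \<in> Nb i.
        zh i j t \<omega> = projM Mb (zh i j (t - 1) \<omega> + \<beta> / real t *
          (gauss_cdf \<sigma> (c i j - zh i j (t - 1) \<omega>)
           - (if rowmul n (K2coef n b) (x j t \<omega>) + d i j t \<omega> \<le> c i j then 1 else 0)))"
    and x_step: "\<forall>\<omega> \<in> space Pr. \<forall>t \<ge> t0 + 1. \<forall>i \<in> {1..N}. \<forall>k \<in> {1..n}.
        x i (t + 1) \<omega> k = Amul n a (x i t \<omega>) k + Bmul n
          (rowmul n (K1coef n a b) (x i t \<omega>)
           + \<gamma> / real (t + 1) * (\<Sum>j \<in> Nb i. zh i j t \<omega> - rowmul n (K2coef n b) (x i t \<omega>))) k"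
  shows
    "(\<beta> > 1 / (2 * fM_const \<sigma> c Mb N Nb) *
        (\<gamma> * (lambdaG N Nb)\<^sup>2 / (lambda2 N Nb) ^ 3 + \<gamma> * alpha_const N Nb)
      \<longrightarrow> (\<forall>i \<in> {1..N}. \<forall>j \<in> Nb i.
            (\<lambda>t. integral\<^sup>L Pr (\<lambda>\<omega>. (rowmul n (K2coef n b) (x i t \<omega>)
                 - rowmul n (K2coef n b) (\<lambda>k. (\<Sum>l \<in> {1..N}. x l t \<omega> k) / real N))\<^sup>2))
              \<longlonglongrightarrow> 0
          \<and> (\<lambda>t. integral\<^sup>L Pr (\<lambda>\<omega>. (zh i j t \<omega> - rowmul n (K2coef n b) (x j t \<omega>))\<^sup>2))
              \<longlonglongrightarrow> 0))
   \<and> (\<gamma> > 1 / lambda2 N Nb \<and>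
      \<beta> > 1 / (2 * fM_const \<sigma> c Mb N Nb) *
        (\<gamma>\<^sup>2 * (lambdaG N Nb)\<^sup>2 / ((lambda2 N Nb)\<^sup>2 * (\<gamma> * lambda2 N Nb - 1))
         + \<gamma> * alpha_const N Nb + 1)
      \<longrightarrow> (\<exists>C > 0. \<forall>i \<in> {1..N}. \<forall>j \<in> Nb i. \<forall>t \<ge> t0 + 1.
            integral\<^sup>L Pr (\<lambda>\<omega>. (rowmul n (K2coef n b) (x i t \<omega>)
                 - rowmul n (K2coef n b) (\<lambda>k. (\<Sum>l \<in> {1..N}. x l t \<omega> k) / real N))\<^sup>2)
              \<le> C / real t
          \<and> integral\<^sup>L Pr (\<lambda>\<omega>. (zh i j t \<omega> - rowmul n (K2coef n b) (x j t \<omega>))\<^sup>2)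
              \<le> C / real t))"
proof -
  define y where "y i t \<omega> = rowmul n (K2coef n b) (x i t \<omega>)" for i t \<omega>
  interpret binary_consensus Pr N Nb c \<sigma> \<beta> \<gamma> Mb t0 d "\<lambda>i. rowmul n (K2coef n b) (x0 i)" z0 y zh
  proof (rule binary_consensus.intro[OF prob], unfold_locales)
    fix \<omega> i assume "\<omega> \<in> space Pr" "i \<in> {1..N}"
    then show "y i (Suc t0) \<omega> = rowmul n (K2coef n b) (x0 i)"
      unfolding y_def rowmul_def using x_init by (intro sum.cong) auto
  next
    fix \<omega> t i assume \<omega>: "\<omega> \<in> space Pr" and t: "t \<ge> Suc t0" and i: "i \<in> {1..N}"
    let ?v = "\<gamma> / real (Suc t) * (\<Sum>j \<in> Nb i. zh i j t \<omega> - y i t \<omega>)"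
    \<comment> \<open>The dynamics fix only the components 1..n of the state, so the next state is
      replaced termwise under the sum in \<open>rowmul\<close>.\<close>
    have "y i (Suc t) \<omega> = rowmul n (K2coef n b)
        (\<lambda>k. Amul n a (x i t \<omega>) k + Bmul n (rowmul n (K1coef n a b) (x i t \<omega>) + ?v) k)"
      unfolding y_def rowmul_def[of n "K2coef n b" "x i (Suc t) \<omega>"]
        rowmul_def[of n "K2coef n b" "\<lambda>k. Amul n a (x i t \<omega>) k + _ k"]
      using x_step \<omega> t i by (intro sum.cong) auto
    then show "y i (Suc t) \<omega> = y i t \<omega> + ?v"
      unfolding rowmul_K2_closed_loop[OF n2] by (simp add: y_def)
  qed (use assms in \<open>auto simp: pairs_def y_def\<close>)
  \<comment> \<open>By linearity, compressing the average state equals averaging the compressed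
    states.\<close>
  have dis_eq: "rowmul n (K2coef n b) (x i t \<omega>)
      - rowmul n (K2coef n b) (\<lambda>k. (\<Sum>l \<in> {1..N}. x l t \<omega> k) / real N) = dis i t \<omega>" for i t \<omega>
    unfolding rowmul_mean by (simp add: dis_def y_def)
  have err_eq: "zh i j t \<omega> - rowmul n (K2coef n b) (x j t \<omega>) = err (i, j) t \<omega>" for i j t \<omega>
    by (simp add: err_def y_def)
  show ?thesis
    unfolding dis_eq err_eq
  proof (intro conjI impI ballI)
    fix i j assume b: "\<beta> > 1 / (2 * fM_const \<sigma> c Mb N Nb) *
        (\<gamma> * (lambdaG N Nb)\<^sup>2 / (lambda2 N Nb) ^ 3 + \<gamma> * alpha_const N Nb)"
      and ij: "i \<in> {1..N}" "j \<in> Nb i"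
    show "(\<lambda>t. expectation (\<lambda>\<omega>. (dis i t \<omega>)\<^sup>2)) \<longlonglongrightarrow> 0"
      by (rule mean_square_convergence(1)[OF b ij(1)])
    show "(\<lambda>t. expectation (\<lambda>\<omega>. (err (i, j) t \<omega>)\<^sup>2)) \<longlonglongrightarrow> 0"
      by (rule mean_square_convergence(2)[OF b pair_mem[OF ij]])
  next
    assume b: "\<gamma> > 1 / lambda2 N Nb \<and> \<beta> > 1 / (2 * fM_const \<sigma> c Mb N Nb) *
        (\<gamma>\<^sup>2 * (lambdaG N Nb)\<^sup>2 / ((lambda2 N Nb)\<^sup>2 * (\<gamma> * lambda2 N Nb - 1))
         + \<gamma> * alpha_const N Nb + 1)"
    obtain C where "C > 0" and C: "\<And>t i. t \<ge> Suc t0 \<Longrightarrow> i \<in> {1..N} \<Longrightarrow> expectation (\<lambda>\<omega>. (dis i t \<omega>)\<^sup>2) \<le> C / real t"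
      "\<And>t p. t \<ge> Suc t0 \<Longrightarrow> p \<in> pairs N Nb \<Longrightarrow> expectation (\<lambda>\<omega>. (err p t \<omega>)\<^sup>2) \<le> C / real t"
      using mean_square_rate[OF conjunct1[OF b] conjunct2[OF b]] by blast
    then show "\<exists>C>0. \<forall>i\<in>{1..N}. \<forall>j\<in>Nb i. \<forall>t\<ge>t0 + 1.
        expectation (\<lambda>\<omega>. (dis i t \<omega>)\<^sup>2) \<le> C / real t \<and>
        expectation (\<lambda>\<omega>. (err (i, j) t \<omega>)\<^sup>2) \<le> C / real t"
      by (intro exI[of _ C]) (auto intro: C(2)[OF _ pair_mem])
  qed
qed

end
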